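(* Let $V$ be a separable infinite-dimensional right quaternionic Hilbert space, let $T\in\mathcal{B}(V)$ and let $P$ be a projection in $\mathcal{B}(V)$ such that $TP=PT$. Set $$T_1:=TP|_{R(P)}\quad\text{and}\quad T_2:=T(\mathbb{I}_V-P)|_{N(P)}.$$ If $\operatorname{dist}(\sigma_S(T_1),\sigma_S(T_2))>0$, then $$R(P)=R\big(P_{\sigma_S(T_1)}\big)\quad\text{and}\quad N(P)=N\big(P_{\sigma_S(T_1)}\big),$$ where $P_{\sigma_S(T_1)}$ is the quaternionic Riesz projection of $T$ associated with $\sigma_S(T_1)$.
   Context: $\mathbb{H}$ is the skew field of quaternions, $\mathbb{S}=\{I\in\mathbb{H}: I^2=-1\}$, $\mathbb{C}_I=\mathbb{R}+I\mathbb{R}$ for $I\in\mathbb{S}$, and $[q]=\{\operatorname{Re}(q)+I|\operatorname{Im}(q)|: I\in\mathbb{S}\}$. A right quaternionic Hilbert space $V$ is a right $\mathbb{H}$-vector space with an $\mathbb{H}$-valued inner product satisfying $\langle f,gq+h\rangle=\langle f,g\rangle q+\langle f,h\rangle$, $\langle f,g\rangle=\overline{\langle g,f\rangle}$, $\langle f,f\rangle\ge 0$ with equality only for $f=0$, and complete for $\|f\|=\sqrt{\langle f,f\rangle}$. $\mathcal{B}(V)$ is the set of bounded right $\mathbb{H}$-linear operators on $V$, $\mathbb{I}_V$ is the identity; $R(\cdot)$ and $N(\cdot)$ denote range and null space. For $T\in\mathcal{B}(V)$ and $q\in\mathbb{H}$, $Q_q(T):=T^2-2\operatorname{Re}(q)T+|q|^2\mathbb{I}_V$;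 $\rho_S(T)$ is the set of $q$ such that $N(Q_q(T))=\{0\}$, $R(Q_q(T))$ is dense in $V$ and $Q_q(T)^{-1}\in\mathcal{B}(V)$, and $\sigma_S(T)=\mathbb{H}\setminus\rho_S(T)$ is the $S$-spectrum (same definition for operators on closed subspaces). A set $U\subset\mathbb{H}$ is axially symmetric if $[x]\subset U$ for all $x\in U$; it is an $s$-domain (slice domain) if $U$ is open, $U\cap\mathbb{R}\neq\emptyset$ and $U\cap\mathbb{C}_I$ is a domain in $\mathbb{C}_I$ for every $I\in\mathbb{S}$. A set $\sigma\subset\sigma_S(T)$ is an isolated part of $\sigma_S(T)$ if both $\sigma$ and $\sigma_S(T)\setminus\sigma$ are closed subsets of $\sigma_S(T)$. In the situation of the claim, $\sigma_S(T)=\sigma_S(T_1)\cup\sigma_S(T_2)$. Fix a Hilbert basis $\mathcal{N}$ of $V$; it induces a left scalar multiplication $qf=\sum_{g\in\mathcal{N}}g\,q\langle g,f\rangle$ on $V$, and $\mathcal{B}(V)$ becomes a two-sided $\mathbb{H}$-module by $(qT)f=q(Tf)$, $(Tq)f=T(qf)$. For $q\in\rho_S(T)$ the left $S$-resolvent operator is $S_L^{-1}(q,T):=-Q_q(T)^{-1}(T-\overline{q}\,\mathbb{I}_V)$. For an axially symmetric isolated part $\sigma$ of $\sigma_S(T)$, let $U_\sigma$ be an axially symmetric $s$-domain that contains $\sigma$ but no other point of $\sigma_S(T)$, and suppose that the Jordan curves $\partial(U_\sigma\cap\mathbb{C}_I)$ lie in $\rho_S(T)$ for every $I\in\mathbb{S}$.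 The quaternionic Riesz projection of $T$ associated with $\sigma$ is $$P_\sigma=\frac{1}{2\pi}\int_{\partial(U_\sigma\cap\mathbb{C}_I)}S_L^{-1}(q,T)\,dq_I,\qquad dq_I=-dq\,I,\quad I\in\mathbb{S};$$ it is a projection that commutes with $T$. *)

theory Defs
  imports "HOL-Complex_Analysis.Complex_Analysis"
begin

datatype quat = Quat (qRe: real) (qIm1: real) (qIm2: real) (qIm3: real)

lemma quat_eq_iff:
  "p = q \<longleftrightarrow> qRe p = qRe q \<and> qIm1 p = qIm1 q \<and> qIm2 p = qIm2 q \<and> qIm3 p = qIm3 q"
  by (auto intro: quat.expand)

instantiation quat :: ab_group_add
begin
definition zero_quat :: quat where "0 = Quat 0 0 0 0"
definition plus_quat :: "quat \<Rightarrow> quat \<Rightarrow> quat" where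
  "p + q = Quat (qRe p + qRe q) (qIm1 p + qIm1 q) (qIm2 p + qIm2 q) (qIm3 p + qIm3 q)"
definition minus_quat :: "quat \<Rightarrow> quat \<Rightarrow> quat" where
  "p - q = Quat (qRe p - qRe q) (qIm1 p - qIm1 q) (qIm2 p - qIm2 q) (qIm3 p - qIm3 q)"
definition uminus_quat :: "quat \<Rightarrow> quat" where
  "- p = Quat (- qRe p) (- qIm1 p) (- qIm2 p) (- qIm3 p)"
instance
  by standard (simp_all add: zero_quat_def plus_quat_def minus_quat_def uminus_quat_def)
end

instantiation quat :: real_vector
begin
definition scaleR_quat :: "real \<Rightarrow> quat \<Rightarrow> quat" where
  "r *\<^sub>R q = Quat (r * qRe q) (r * qIm1 q) (r * qIm2 q) (r * qIm3 q)"
instance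
  by standard (simp_all add: scaleR_quat_def plus_quat_def algebra_simps)
end

instantiation quat :: real_algebra_1
begin
definition one_quat :: quat where "1 = Quat 1 0 0 0"
definition times_quat :: "quat \<Rightarrow> quat \<Rightarrow> quat" where
  "p * q = Quat
     (qRe p * qRe q - qIm1 p * qIm1 q - qIm2 p * qIm2 q - qIm3 p * qIm3 q)
     (qRe p * qIm1 q + qIm1 p * qRe q + qIm2 p * qIm3 q - qIm3 p * qIm2 q)
     (qRe p * qIm2 q - qIm1 p * qIm3 q + qIm2 p * qRe q + qIm3 p * qIm1 q)
     (qRe p * qIm3 q + qIm1 p * qIm2 q - qIm2 p * qIm1 q + qIm3 p * qRe q)"
instance
  by standard
    (simp_all add: zero_quat_def one_quat_def plus_quat_def times_quat_def scaleR_quat_def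
      algebra_simps)
end

instantiation quat :: real_inner
begin
definition inner_quat :: "quat \<Rightarrow> quat \<Rightarrow> real" where
  "p \<bullet> q = qRe p * qRe q + qIm1 p * qIm1 q + qIm2 p * qIm2 q + qIm3 p * qIm3 q"
definition norm_quat :: "quat \<Rightarrow> real" where "norm (q :: quat) = sqrt (q \<bullet> q)"
definition sgn_quat :: "quat \<Rightarrow> quat" where "sgn (q :: quat) = q /\<^sub>R norm q"
definition dist_quat :: "quat \<Rightarrow> quat \<Rightarrow> real" where "dist p q = norm (p - q :: quat)"
definition uniformity_quat :: "(quat \<times> quat) filter" where
  "uniformity_quat = (INF e\<in>{0<..}. principal {(x, y). dist x y < e})"
definition open_quat :: "quat set \<Rightarrow> bool" where
  "open_quat U \<longleftrightarrow> (\<forall>x\<in>U. eventually (\<lambda>(x', y). x' = x \<longrightarrow> y \<in> U) uniformity)"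
instance
proof
  fix x y z :: quat and r :: real
  show "x \<bullet> y = y \<bullet> x" "(x + y) \<bullet> z = x \<bullet> z + y \<bullet> z" "(r *\<^sub>R x) \<bullet> y = r * (x \<bullet> y)" "0 \<le> x \<bullet> x"
    by (simp_all add: inner_quat_def plus_quat_def scaleR_quat_def algebra_simps)
  show "x \<bullet> x = 0 \<longleftrightarrow> x = 0"
    by (cases x) (auto simp: inner_quat_def zero_quat_def add_nonneg_eq_0_iff)
qed (simp_all add: norm_quat_def sgn_quat_def dist_quat_def uniformity_quat_def open_quat_def)
end

definition qcnj :: "quat \<Rightarrow> quat" where
  "qcnj q = Quat (qRe q) (- qIm1 q) (- qIm2 q) (- qIm3 q)"

lemma qcnj_mult_self: "qcnj q * q = of_real (q \<bullet> q)" "q * qcnj q = of_real (q \<bullet> q)"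
  by (simp_all add: qcnj_def of_real_def times_quat_def scaleR_quat_def one_quat_def inner_quat_def
      algebra_simps)

instantiation quat :: real_normed_div_algebra
begin
definition inverse_quat :: "quat \<Rightarrow> quat" where "inverse q = qcnj q /\<^sub>R (q \<bullet> q)"
definition divide_quat :: "quat \<Rightarrow> quat \<Rightarrow> quat" where "p div (q :: quat) = p * inverse q"
instance
proof
  fix x y :: quat
  show "x \<noteq> 0 \<Longrightarrow> inverse x * x = 1" "x \<noteq> 0 \<Longrightarrow> x * inverse x = 1"
    by (simp_all add: inverse_quat_def qcnj_mult_self of_real_def)
  show "x div y = x * inverse y" by (fact divide_quat_def)
  show "inverse (0 :: quat) = 0" by (simp add: inverse_quat_def inner_quat_def zero_quat_def)
  have "(x * y) \<bullet> (x * y) = (x \<bullet> x) * (y \<bullet> y)"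
    by (simp add: inner_quat_def times_quat_def algebra_simps)
  then show "norm (x * y) = norm x * norm y"
    by (simp add: norm_quat_def real_sqrt_mult)
qed
end

definition imag_units :: "quat set" (\<open>\<S>\<close>) where
  "\<S> = {I. I^2 = - 1}"

definition qsphere :: "quat \<Rightarrow> quat set" where
  "qsphere q = {of_real (qRe q) + I * of_real (norm (q - of_real (qRe q))) | I. I \<in> \<S>}"

definition axially_symmetric :: "quat set \<Rightarrow> bool" where
  "axially_symmetric U \<longleftrightarrow> (\<forall>x\<in>U. qsphere x \<subseteq> U)"

text \<open>For \<open>I \<in> \<S>\<close>, \<open>slice_emb I\<close> is the isometric isomorphism \<open>x + \<i>y \<mapsto> x + Iy\<close> of
  \<open>\<complex>\<close> with \<open>slice I\<close>.\<close>

definition slice_emb :: "quat \<Rightarrow> complex \<Rightarrow> quat" where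
  "slice_emb I z = of_real (Re z) + I * of_real (Im z)"

definition slice :: "quat \<Rightarrow> quat set" where
  "slice I = range (slice_emb I)"

definition s_domain :: "quat set \<Rightarrow> bool" where
  "s_domain U \<longleftrightarrow> open U \<and> U \<inter> \<real> \<noteq> {} \<and>
     (\<forall>I\<in>\<S>. openin (top_of_set (slice I)) (U \<inter> slice I) \<and> connected (U \<inter> slice I))"

definition slice_frontier :: "quat \<Rightarrow> quat set \<Rightarrow> quat set" where
  "slice_frontier I U = top_of_set (slice I) frontier_of (U \<inter> slice I)"

text \<open>Unlike \<open>setdist\<close>, which is \<open>0\<close> if one of the sets is empty, this is then \<open>\<infinity>\<close>.\<close>

definition set_distance :: "'a::metric_space set \<Rightarrow> 'a set \<Rightarrow> ereal" where
  "set_distance A B = (INF x\<in>A. INF y\<in>B. ereal (dist x y))"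

text \<open>The real normed structure is the one induced by the quaternionic structure; completeness is
  part of \<^class>\<open>banach\<close>.\<close>

class right_quaternionic_hilbert_space = banach +
  fixes qscale :: "'a \<Rightarrow> quat \<Rightarrow> 'a" (infixl \<open>\<cdot>\<close> 75)
    and qinner :: "'a \<Rightarrow> 'a \<Rightarrow> quat"
  assumes qscale_add_left: "(f + g) \<cdot> q = f \<cdot> q + g \<cdot> q"
    and qscale_add_right: "f \<cdot> (p + q) = f \<cdot> p + f \<cdot> q"
    and qscale_qscale: "(f \<cdot> p) \<cdot> q = f \<cdot> (p * q)"
    and qscale_one: "f \<cdot> 1 = f"
    and scaleR_eq_qscale: "r *\<^sub>R f = f \<cdot> of_real r"
    and qinner_right: "qinner f (g \<cdot> q + h) = qinner f g * q + qinner f h"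
    and qinner_commute: "qinner f g = qcnj (qinner g f)"
    and qinner_self: "qinner f f = of_real (qRe (qinner f f))" "0 \<le> qRe (qinner f f)"
    and qinner_eq_0: "qinner f f = 0 \<Longrightarrow> f = 0"
    and norm_eq_qinner: "norm f = sqrt (qRe (qinner f f))"

definition qspan :: "'v::right_quaternionic_hilbert_space set \<Rightarrow> 'v set" where
  "qspan S = {\<Sum>b\<in>B. b \<cdot> c b | B c. finite B \<and> B \<subseteq> S}"

definition hilbert_basis :: "'v::right_quaternionic_hilbert_space set \<Rightarrow> bool" where
  "hilbert_basis N \<longleftrightarrow>
     (\<forall>g\<in>N. \<forall>h\<in>N. qinner g h = (if g = h then 1 else 0)) \<and> closure (qspan N) = UNIV"

definition right_linear_ops :: "('v::right_quaternionic_hilbert_space \<Rightarrow>\<^sub>L 'v) set" (\<open>\<B>\<close>) where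
  "\<B> = {T :: 'v \<Rightarrow>\<^sub>L 'v. \<forall>f q. T (f \<cdot> q) = T f \<cdot> q}"

text \<open>The left multiplication induced by \<open>N\<close>, as an element of \<open>\<B>\<close>; the operators
  \<open>qT\<close> and \<open>Tq\<close> are \<open>left_mult N q o\<^sub>L T\<close> and \<open>T o\<^sub>L left_mult N q\<close>.\<close>

definition left_mult ::
  "'v::right_quaternionic_hilbert_space set \<Rightarrow> quat \<Rightarrow> 'v \<Rightarrow>\<^sub>L 'v" where
  "left_mult N q = Blinfun (\<lambda>f. \<Sum>\<^sub>\<infinity>g\<in>N. g \<cdot> (q * qinner g f))"

definition Q_op ::
  "quat \<Rightarrow> ('v::right_quaternionic_hilbert_space \<Rightarrow>\<^sub>L 'v) \<Rightarrow> 'v \<Rightarrow>\<^sub>L 'v" where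
  "Q_op q T = (T o\<^sub>L T) - (2 * qRe q) *\<^sub>R T + (norm q)^2 *\<^sub>R id_blinfun"

definition bounded_right_linear_on ::
  "'v::right_quaternionic_hilbert_space set \<Rightarrow> ('v \<Rightarrow> 'v) \<Rightarrow> bool" where
  "bounded_right_linear_on W B \<longleftrightarrow> B ` W \<subseteq> W \<and>
     (\<forall>f\<in>W. \<forall>g\<in>W. \<forall>q. B (f \<cdot> q + g) = B f \<cdot> q + B g) \<and>
     (\<exists>K. \<forall>f\<in>W. norm (B f) \<le> K * norm f)"

text \<open>\<open>S_resolvent_set_on W T\<close> is the S-resolvent set of the restriction of \<open>T\<close> to a closed
  \<open>T\<close>-invariant subspace \<open>W\<close>, regarded as an operator on the Hilbert space \<open>W\<close>.\<close>

definition S_resolvent_set_on ::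
  "'v::right_quaternionic_hilbert_space set \<Rightarrow> ('v \<Rightarrow>\<^sub>L 'v) \<Rightarrow> quat set" where
  "S_resolvent_set_on W T =
     {q. {f \<in> W. Q_op q T f = 0} = {0} \<and>
         W \<subseteq> closure (Q_op q T ` W) \<and>
         (\<exists>B. bounded_right_linear_on W B \<and>
              (\<forall>f\<in>W. B (Q_op q T f) = f \<and> Q_op q T (B f) = f))}"

definition S_spectrum_on ::
  "'v::right_quaternionic_hilbert_space set \<Rightarrow> ('v \<Rightarrow>\<^sub>L 'v) \<Rightarrow> quat set" where
  "S_spectrum_on W T = - S_resolvent_set_on W T"

abbreviation S_resolvent_set ::
  "('v::right_quaternionic_hilbert_space \<Rightarrow>\<^sub>L 'v) \<Rightarrow> quat set" (\<open>\<rho>\<^sub>S\<close>) where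
  "\<rho>\<^sub>S T \<equiv> S_resolvent_set_on UNIV T"

abbreviation S_spectrum ::
  "('v::right_quaternionic_hilbert_space \<Rightarrow>\<^sub>L 'v) \<Rightarrow> quat set" (\<open>\<sigma>\<^sub>S\<close>) where
  "\<sigma>\<^sub>S T \<equiv> S_spectrum_on UNIV T"

definition left_S_resolvent ::
  "'v::right_quaternionic_hilbert_space set \<Rightarrow> quat \<Rightarrow> ('v \<Rightarrow>\<^sub>L 'v) \<Rightarrow> 'v \<Rightarrow>\<^sub>L 'v" where
  "left_S_resolvent N q T =
     - (Blinfun (inv (blinfun_apply (Q_op q T))) o\<^sub>L (T - left_mult N (qcnj q)))"

definition riesz_domain ::
  "('v::right_quaternionic_hilbert_space \<Rightarrow>\<^sub>L 'v) \<Rightarrow> quat set \<Rightarrow> quat set \<Rightarrow> bool" where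
  "riesz_domain T \<sigma> U \<longleftrightarrow> axially_symmetric U \<and> s_domain U \<and> U \<inter> \<sigma>\<^sub>S T = \<sigma> \<and>
     (\<forall>I\<in>\<S>. slice_frontier I U \<subseteq> \<rho>\<^sub>S T)"

text \<open>\<open>\<Gamma>\<close> lists piecewise \<open>C\<^sup>1\<close> parametrisations (in the coordinate of \<^const>\<open>slice_emb\<close>) of
  Jordan curves that make up the boundary of \<open>U \<inter> \<complex>\<^sub>I\<close>. The last two conditions are the
  positive orientation (\<open>U \<inter> \<complex>\<^sub>I\<close> lies to the left of each curve, so that the boundaries of holes
  run clockwise); they also make \<open>U \<inter> \<complex>\<^sub>I\<close> bounded.\<close>

definition oriented_boundary :: "quat \<Rightarrow> quat set \<Rightarrow> (real \<Rightarrow> complex) list \<Rightarrow> bool" where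
  "oriented_boundary I U \<Gamma> \<longleftrightarrow>
     (\<forall>\<gamma>\<in>set \<Gamma>. valid_path \<gamma> \<and> simple_path \<gamma> \<and> pathfinish \<gamma> = pathstart \<gamma>) \<and>
     slice_frontier I U = (\<Union>\<gamma>\<in>set \<Gamma>. slice_emb I ` path_image \<gamma>) \<and>
     (\<forall>z. slice_emb I z \<in> U \<longrightarrow> (\<Sum>\<gamma>\<leftarrow>\<Gamma>. winding_number \<gamma> z) = 1) \<and>
     (\<forall>z. slice_emb I z \<notin> U \<union> slice_frontier I U \<longrightarrow> (\<Sum>\<gamma>\<leftarrow>\<Gamma>. winding_number \<gamma> z) = 0)"

text \<open>The integral is taken in the Banach space of bounded operators. Along \<open>q(t)\<close>,
  \<open>dq\<^sub>I = - dq I\<close> is \<open>- q'(t) I dt\<close>.\<close>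

definition slice_integral ::
  "'v::right_quaternionic_hilbert_space set \<Rightarrow> quat \<Rightarrow> (real \<Rightarrow> complex) \<Rightarrow>
     (quat \<Rightarrow> 'v \<Rightarrow>\<^sub>L 'v) \<Rightarrow> 'v \<Rightarrow>\<^sub>L 'v" where
  "slice_integral N I \<gamma> F = integral {0..1} (\<lambda>t.
     F (slice_emb I (\<gamma> t)) o\<^sub>L
     left_mult N (- vector_derivative (slice_emb I \<circ> \<gamma>) (at t within {0..1}) * I))"

definition riesz_projection ::
  "'v::right_quaternionic_hilbert_space set \<Rightarrow> quat \<Rightarrow> (real \<Rightarrow> complex) list \<Rightarrow>
     ('v \<Rightarrow>\<^sub>L 'v) \<Rightarrow> 'v \<Rightarrow>\<^sub>L 'v" where
  "riesz_projection N I \<Gamma> T =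
     (1 / (2 * pi)) *\<^sub>R (\<Sum>\<gamma>\<leftarrow>\<Gamma>. slice_integral N I \<gamma> (\<lambda>q. left_S_resolvent N q T))"

end

theory Submission
  imports Defs
begin

text \<open>Right multiplication by \<open>\<complex>\<^sub>i\<close> commutes with every operator in \<open>\<B>\<close>, so it makes \<open>V\<close> a complex Banach
  space on which \<open>T\<close> and \<open>P\<close> are complex linear, and \<open>Q_op q T\<close> with \<open>q = x + Iy\<close> factors as
  \<open>(z - T) (cnj z - T)\<close> with \<open>z = x + \<i>y\<close>, independently of \<open>I\<close>. Relative to \<open>P\<close> the resolvent
  \<open>(z - T)\<inverse>\<close> is holomorphic off \<open>U\<close> and behaves like \<open>1/z\<close> at infinity, relative to \<open>1 - P\<close> it is
  holomorphic on the closure of \<open>U\<close>. Cauchy's theorem, applied to matrix coefficients, yields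
  \<open>\<integral> (z - T)\<inverse> dz = 2\<pi>\<i> P\<close>.

  Write \<open>(z - T)\<inverse> dz = A + \<i> B\<close> with \<open>A\<close>, \<open>B\<close> quaternionic linear. Then the integrand of the Riesz
  projection is \<open>B - A L\<close>, where \<open>L\<close> is the left multiplication by \<open>I\<close>. Since conjugation with \<open>j\<close> fixes
  \<open>A\<close> and \<open>B\<close> and changes the sign of \<open>\<i>\<close>, the identity above separates into \<open>\<integral> A = 0\<close> and
  \<open>\<integral> B = 2\<pi> P\<close>; hence the Riesz projection equals \<open>P\<close>.\<close>

section \<open>Cauchy theorems for boundary cycles\<close>

text \<open>The loops are linked by a path \<open>p\<close> inside \<open>S\<close> that is run
  forth and back, so its contributions cancel. A polynomial \<open>p\<close> is automatically a
  valid path. One loop \<open>k\<close> serves every holomorphic \<open>f\<close>, so that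
  \<open>f\<close> and \<open>1 / (z - w)\<close> can share it later.\<close>

lemma loops_join:
  assumes S: "open S" "connected S"
    and g: "valid_path g" "pathfinish g = pathstart g" "path_image g \<subseteq> S"
    and h: "valid_path h" "pathfinish h = pathstart h" "path_image h \<subseteq> S"
  obtains k where "valid_path k" "pathfinish k = pathstart k" "path_image k \<subseteq> S"
    "\<And>f. f holomorphic_on S \<Longrightarrow>
       contour_integral k f = contour_integral g f + contour_integral h f"
proof -
  have "pathstart g \<in> S" "pathstart h \<in> S"
    using g h by auto
  then obtain p where p: "polynomial_function p" "path_image p \<subseteq> S"
      "pathstart p = pathstart g" "pathfinish p = pathstart h"
    using S connected_open_polynomial_connected by blast
  then have vp: "valid_path p"
    by (simp add: valid_path_polynomial_function)
  define k where "k = g +++ (p +++ (h +++ reversepath p))"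
  show thesis
  proof
    show "valid_path k" "pathfinish k = pathstart k" "path_image k \<subseteq> S"
      using g h p vp by (auto simp: k_def path_image_join valid_path_join)
    fix f :: "complex \<Rightarrow> complex" assume f: "f holomorphic_on S"
    have int: "f contour_integrable_on q" if "valid_path q" "path_image q \<subseteq> S" for q
      using contour_integrable_holomorphic_simple[OF f \<open>open S\<close> that] .
    show "contour_integral k f = contour_integral g f + contour_integral h f"
      using g h p vp
      by (simp add: k_def contour_integral_join contour_integral_reversepath int
          path_image_join contour_integrable_join)
  qed
qed

text \<open>Reduces a cycle to one closed path, so that theorems on a single loop apply to all
  boundary curves together. A point of \<open>S\<close> supplies the constant loop for the empty
  cycle.\<close>

lemma loops_join_list:
  assumes S: "open S" "connected S" "S \<noteq> {}"
    and \<Gamma>: "\<And>\<gamma>. \<gamma> \<in> set \<Gamma> \<Longrightarrow>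
      valid_path \<gamma> \<and> pathfinish \<gamma> = pathstart \<gamma> \<and> path_image \<gamma> \<subseteq> S"
  obtains k where "valid_path k" "pathfinish k = pathstart k" "path_image k \<subseteq> S"
    "\<And>f. f holomorphic_on S \<Longrightarrow> contour_integral k f = (\<Sum>\<gamma>\<leftarrow>\<Gamma>. contour_integral \<gamma> f)"
  using \<Gamma>
proof (induction \<Gamma> arbitrary: thesis)
  case Nil
  from S obtain a where "a \<in> S" by blast
  then show ?case
    by (intro Nil(1)[of "linepath a a"]) (auto simp del: linepath_trivial)
next
  case (Cons g \<Gamma>)
  obtain h where h: "valid_path h" "pathfinish h = pathstart h" "path_image h \<subseteq> S"
    "\<And>f. f holomorphic_on S \<Longrightarrow> contour_integral h f = (\<Sum>\<gamma>\<leftarrow>\<Gamma>. contour_integral \<gamma> f)"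
    using Cons.IH Cons.prems(2) by (metis list.set_intros(2))
  obtain k where "valid_path k" "pathfinish k = pathstart k" "path_image k \<subseteq> S"
    "\<And>f. f holomorphic_on S \<Longrightarrow>
       contour_integral k f = contour_integral g f + contour_integral h f"
    using loops_join[OF S(1,2) _ _ _ h(1-3)] Cons.prems(2) by (metis list.set_intros(1))
  with h(4) show ?case
    by (intro Cons.prems(1)[of k]) auto
qed

text \<open>The homology form of Cauchy's theorem for a cycle. The winding number of the joined loop
  is the sum of the individual ones, because a winding number about \<open>w\<close> outside
  \<open>S\<close> is itself an integral of a function holomorphic on \<open>S\<close>.\<close>

lemma Cauchy_theorem_global_list:
  assumes S: "open S" "connected S" and f: "f holomorphic_on S"
    and \<Gamma>: "\<And>\<gamma>. \<gamma> \<in> set \<Gamma> \<Longrightarrow>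
      valid_path \<gamma> \<and> pathfinish \<gamma> = pathstart \<gamma> \<and> path_image \<gamma> \<subseteq> S"
    and zero: "\<And>w. w \<notin> S \<Longrightarrow> (\<Sum>\<gamma>\<leftarrow>\<Gamma>. winding_number \<gamma> w) = 0"
  shows "(\<Sum>\<gamma>\<leftarrow>\<Gamma>. contour_integral \<gamma> f) = 0"
proof (cases "\<Gamma> = []")
  case False
  then have "S \<noteq> {}"
    using \<Gamma>[of "hd \<Gamma>"] path_image_nonempty[of "hd \<Gamma>"] by force
  then obtain k where k: "valid_path k" "pathfinish k = pathstart k" "path_image k \<subseteq> S"
    and int: "\<And>f. f holomorphic_on S \<Longrightarrow>
      contour_integral k f = (\<Sum>\<gamma>\<leftarrow>\<Gamma>. contour_integral \<gamma> f)"
    using loops_join_list[OF S _ \<Gamma>] by blast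
  have "winding_number k w = 0" if w: "w \<notin> S" for w
  proof -
    have "winding_number \<gamma> w = 1/(2*pi*\<i>) * contour_integral \<gamma> (\<lambda>z. 1 / (z - w))"
      if "valid_path \<gamma>" "path_image \<gamma> \<subseteq> S" for \<gamma>
      using that w by (intro winding_number_valid_path) auto
    moreover have "(\<lambda>z. 1 / (z - w)) holomorphic_on S"
      using w by (intro holomorphic_intros) auto
    ultimately have "winding_number k w =
        1/(2*pi*\<i>) * (\<Sum>\<gamma>\<leftarrow>\<Gamma>. contour_integral \<gamma> (\<lambda>z. 1 / (z - w)))"
      using k int by simp
    also have "\<dots> = (\<Sum>\<gamma>\<leftarrow>\<Gamma>. 1/(2*pi*\<i>) * contour_integral \<gamma> (\<lambda>z. 1 / (z - w)))"
      by (rule sum_list_const_mult[symmetric])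
    also have "\<dots> = (\<Sum>\<gamma>\<leftarrow>\<Gamma>. winding_number \<gamma> w)"
      using \<Gamma> w by (intro arg_cong[where f=sum_list] map_cong refl)
        (metis subset_iff winding_number_valid_path)
    finally show ?thesis
      using zero[OF w] by simp
  qed
  then have "(f has_contour_integral 0) k"
    using Cauchy_theorem_global[OF S(1) f k] by blast
  then show ?thesis
    using int[OF f] contour_integral_unique by fastforce
qed simp

text \<open>Joining loops takes place in a connected open set, whereas the set where a resolvent
  exists may be disconnected; the component that contains \<open>A\<close> replaces it.\<close>

lemma connected_component_superset:
  assumes "connected A" "A \<subseteq> S" "A \<noteq> {}" "open (S::complex set)"
  obtains C where "open C" "connected C" "A \<subseteq> C" "C \<subseteq> S"
proof -
  obtain a where "a \<in> A" using assms by blast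
  show thesis
  proof
    show "open (connected_component_set S a)" by (rule open_connected_component[OF assms(4)])
    show "A \<subseteq> connected_component_set S a"
      using \<open>a \<in> A\<close> assms by (intro connected_component_maximal) auto
  qed (auto simp: connected_component_subset)
qed

lemma Cauchy_theorem_boundary:
  assumes D: "open D" "connected D"
    and \<Gamma>: "\<And>\<gamma>. \<gamma> \<in> set \<Gamma> \<Longrightarrow> valid_path \<gamma> \<and> simple_path \<gamma> \<and> pathfinish \<gamma> = pathstart \<gamma>"
    and frontier: "frontier D = (\<Union>\<gamma>\<in>set \<Gamma>. path_image \<gamma>)"
    and zero: "\<And>z. z \<notin> D \<union> frontier D \<Longrightarrow> (\<Sum>\<gamma>\<leftarrow>\<Gamma>. winding_number \<gamma> z) = 0"
    and S: "open S" "closure D \<subseteq> S" and f: "f holomorphic_on S"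
  shows "(\<Sum>\<gamma>\<leftarrow>\<Gamma>. contour_integral \<gamma> f) = 0"
proof (cases "D = {}")
  case True
  then have "\<Gamma> = []"
    using frontier path_image_nonempty by (cases \<Gamma>) auto
  then show ?thesis by simp
next
  case False
  then obtain C where C: "open C" "connected C" "closure D \<subseteq> C" "C \<subseteq> S"
    using connected_component_superset[of "closure D" S] D S by (auto simp: connected_imp_connected_closure)
  have cl: "closure D = D \<union> frontier D"
    by (simp add: Un_commute closure_Un_frontier)
  show ?thesis
  proof (rule Cauchy_theorem_global_list[OF C(1,2)])
    show "f holomorphic_on C" using f C by (rule_tac holomorphic_on_subset)
    show "valid_path \<gamma> \<and> pathfinish \<gamma> = pathstart \<gamma> \<and> path_image \<gamma> \<subseteq> C" if "\<gamma> \<in> set \<Gamma>" for \<gamma>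
      using \<Gamma>[OF that] C cl frontier that by blast
    \<comment> \<open>A point off \<open>C\<close> is also off the closure of \<open>D\<close>,
      where the winding numbers cancel by assumption.\<close>
    show "(\<Sum>\<gamma>\<leftarrow>\<Gamma>. winding_number \<gamma> w) = 0" if "w \<notin> C" for w
      using zero[of w] that C cl by blast
  qed
qed

section \<open>Residues at infinity\<close>

text \<open>On the circle \<open>f\<close> differs from \<open>c / z\<close> by at most
  \<open>C / R^2\<close>, and the circle has length \<open>2 * pi * R\<close>.\<close>

lemma circlepath_integral_asymptotic:
  assumes R: "0 < R" and f: "f holomorphic_on S" "open S" "path_image (circlepath 0 R) \<subseteq> S"
    and bound: "\<And>z. norm z = R \<Longrightarrow> norm (z * f z - c) \<le> C / R" and "0 \<le> C"
  shows "norm (contour_integral (circlepath 0 R) f - 2 * pi * \<i> * c) \<le> 2 * pi * C / R"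
proof -
  have "f contour_integrable_on circlepath 0 R"
    using f by (intro contour_integrable_holomorphic_simple) auto
  then have "(f has_contour_integral contour_integral (circlepath 0 R) f) (circlepath 0 R)"
    by (simp add: has_contour_integral_integral)
  moreover have "((\<lambda>z. c / (z - 0)) has_contour_integral 2 * pi * \<i> * c) (circlepath 0 R)"
    using Cauchy_integral_circlepath_simple[of "\<lambda>_. c" 0 R 0] R by simp
  ultimately have "((\<lambda>z. f z - c / (z - 0)) has_contour_integral
      contour_integral (circlepath 0 R) f - 2 * pi * \<i> * c) (circlepath 0 R)"
    by (rule has_contour_integral_diff)
  moreover have "norm (f z - c / (z - 0)) \<le> C / R ^ 2" if "norm (z - 0) = R" for z
  proof -
    have "f z - c / (z - 0) = (z * f z - c) / z"
      using that R by (auto simp: field_simps)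
    then have "norm (f z - c / (z - 0)) = norm (z * f z - c) / R"
      using that by (simp add: norm_divide)
    also have "\<dots> \<le> C / R / R"
      using bound[of z] that R by (intro divide_right_mono) auto
    finally show ?thesis by (simp add: power2_eq_square)
  qed
  ultimately have "norm (contour_integral (circlepath 0 R) f - 2 * pi * \<i> * c) \<le> C / R^2 * (2 * pi * R)"
    using R \<open>0 \<le> C\<close> by (intro has_contour_integral_bound_circlepath) auto
  also have "\<dots> = 2 * pi * C / R"
    using R by (simp add: power2_eq_square)
  finally show ?thesis .
qed

text \<open>Here \<open>f\<close> is holomorphic off \<open>D\<close> and behaves like
  \<open>c / z\<close> at infinity. Being connected and disjoint from the curve, \<open>D\<close>
  lies entirely outside or entirely inside it. In the first case Cauchy's theorem gives zero; in the
  second the curve is moved outwards to a large circle.\<close>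

lemma Jordan_curve_residue_at_infinity:
  assumes D: "open D" "connected D" "D \<noteq> {}"
    and \<gamma>: "valid_path \<gamma>" "simple_path \<gamma>" "pathfinish \<gamma> = pathstart \<gamma>" "path_image \<gamma> \<inter> D = {}"
    and S: "open S" "- D \<subseteq> S" and f: "f holomorphic_on S"
    and bound: "\<And>z. z \<in> S \<Longrightarrow> R0 \<le> norm z \<Longrightarrow> norm (z * f z - c) \<le> C / norm z"
    and w: "w \<in> D"
  shows "contour_integral \<gamma> f = 2 * pi * \<i> * c * winding_number \<gamma> w"
proof -
  let ?in = "inside (path_image \<gamma>)" and ?out = "outside (path_image \<gamma>)"
  have J: "?in \<noteq> {}" "open ?in" "connected ?in" "?out \<noteq> {}" "open ?out" "connected ?out"
      "bounded ?in" "?in \<inter> ?out = {}" "?in \<union> ?out = - path_image \<gamma>"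
      "frontier ?in = path_image \<gamma>" "frontier ?out = path_image \<gamma>"
    using Jordan_inside_outside[OF \<gamma>(2,3)] by auto
  have "path \<gamma>" using \<gamma> by (simp add: valid_path_imp_path)
  have "D \<subseteq> ?in \<or> D \<subseteq> ?out"
    using connectedD[OF D(2) J(2,5)] J(8,9) \<gamma>(4) by blast
  then show ?thesis
  proof
    assume out: "D \<subseteq> ?out"
    have "winding_number \<gamma> z = 0" if "z \<in> D" for z
      using out that \<open>path \<gamma>\<close> \<gamma>(3) by (intro winding_number_zero_in_outside) auto
    \<comment> \<open>The complement of \<open>S\<close> lies in \<open>D\<close>, hence outside the
      curve.\<close>
    moreover from this have "(f has_contour_integral 0) \<gamma>"
      using S \<gamma> by (intro Cauchy_theorem_global[OF S(1) f]) auto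
    ultimately show ?thesis
      using w contour_integral_unique by fastforce
  next
    assume inn: "D \<subseteq> ?in"
    define n where "n = winding_number \<gamma> w"
    have n: "winding_number \<gamma> z = n" if "z \<in> ?in" for z
      unfolding n_def
      using winding_number_constant[of \<gamma> ?in] \<open>path \<gamma>\<close> \<gamma>(3) J inn w that
      by (auto simp: constant_on_def)
    have n1: "n = 1 \<or> n = -1"
      using simple_closed_path_winding_number_inside[OF \<gamma>(2)] inn w
      unfolding n_def by (metis subset_iff)
    have "bounded (?in \<union> path_image \<gamma>)"
      using J(7) \<gamma>(1) by (simp add: bounded_path_image valid_path_imp_path)
    then obtain R1 where R1: "?in \<union> path_image \<gamma> \<subseteq> ball 0 R1"
      using bounded_subset_ballD by blast
    have "connected (closure ?out)" using J(6) by (rule connected_imp_connected_closure)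
    have clout: "closure ?out = ?out \<union> path_image \<gamma>"
      using J(11) closure_Un_frontier by blast
    \<comment> \<open>The component of \<open>S\<close> around the closed outer region: it contains
      the curve and all large circles, and every point missing from it lies inside the curve, where
      the winding number is \<open>n\<close>.\<close>
    obtain S' where S': "open S'" "connected S'" "closure ?out \<subseteq> S'" "S' \<subseteq> S"
    proof (rule connected_component_superset[OF _ _ _ S(1)])
      show "closure ?out \<subseteq> S" using clout inn J(8) \<gamma>(4) S(2) by blast
    qed (use J in \<open>auto simp: connected_imp_connected_closure\<close>)
    have inS': "z \<in> ?in" if "z \<notin> S'" for z
      using that S'(3) clout J(9) by blast
    have fS': "f holomorphic_on S'" using f S' by (rule_tac holomorphic_on_subset)
    have key: "norm (contour_integral \<gamma> f - 2 * pi * \<i> * c * n) \<le> 2 * pi * \<bar>C\<bar> / R"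
      if R: "R > 0" "R \<ge> R1" "R \<ge> R0" for R
    proof -
      let ?k = "circlepath 0 R"
      have k: "valid_path ?k" "pathfinish ?k = pathstart ?k" "path_image ?k \<subseteq> S'"
      proof -
        show "path_image ?k \<subseteq> S'"
          using R R1 inS' by (fastforce simp: subset_iff)
      qed auto
      \<comment> \<open>The large circle is oriented against \<open>\<gamma>\<close>, so the two
        winding numbers cancel at every inner point.\<close>
      define k where "k = (if n = 1 then reversepath ?k else ?k)"
      have wk: "winding_number ?k z = 1" if "z \<in> ?in" for z
        using R R1 that by (intro winding_number_circlepath) auto
      have "(\<Sum>\<gamma>\<leftarrow>[\<gamma>, k]. contour_integral \<gamma> f) = 0"
      proof (rule Cauchy_theorem_global_list[OF S'(1,2) fS'])
        show "valid_path g \<and> pathfinish g = pathstart g \<and> path_image g \<subseteq> S'"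
          if "g \<in> set [\<gamma>, k]" for g
          using that k \<gamma> S'(3) clout by (auto simp: k_def split: if_splits)
        show "(\<Sum>\<gamma>\<leftarrow>[\<gamma>, k]. winding_number \<gamma> z) = 0" if "z \<notin> S'" for z
        proof -
          have "z \<in> ?in" using inS' that by blast
          moreover have "winding_number (reversepath ?k) z = - winding_number ?k z"
            using k(3) that by (intro winding_number_reversepath) auto
          ultimately show ?thesis
            using n n1 wk by (auto simp: k_def)
        qed
      qed
      moreover have "contour_integral k f = - n * contour_integral ?k f"
        using n1 by (auto simp: k_def contour_integral_reversepath)
      ultimately have "contour_integral \<gamma> f - 2 * pi * \<i> * c * n
          = n * (contour_integral ?k f - 2 * pi * \<i> * c)"
        by (simp add: algebra_simps add_eq_0_iff)
      then have "norm (contour_integral \<gamma> f - 2 * pi * \<i> * c * n)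
          = norm (contour_integral ?k f - 2 * pi * \<i> * c)"
        using n1 by (auto simp: norm_mult)
      also have "\<dots> \<le> 2 * pi * \<bar>C\<bar> / R"
      proof (rule circlepath_integral_asymptotic[OF R(1) fS' S'(1) k(3)])
        fix z :: complex assume z: "norm z = R"
        then have "z \<in> S" using k(3) S'(4) R(1) by auto
        then have "norm (z * f z - c) \<le> C / R"
          using bound[of z] z R by simp
        also have "\<dots> \<le> \<bar>C\<bar> / R"
          using R by (intro divide_right_mono) auto
        finally show "norm (z * f z - c) \<le> \<bar>C\<bar> / R" .
      qed auto
      finally show ?thesis .
    qed
    \<comment> \<open>The left-hand side does not depend on \<open>R\<close>, so letting
      \<open>R\<close> tend to infinity makes it vanish.\<close>
    have "norm (contour_integral \<gamma> f - 2 * pi * \<i> * c * n) \<le> 0"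
    proof (rule tendsto_lowerbound)
      show "((\<lambda>R. 2 * pi * \<bar>C\<bar> / R) \<longlongrightarrow> 0) at_top"
        by real_asymp
      show "\<forall>\<^sub>F R in at_top. norm (contour_integral \<gamma> f - 2 * pi * \<i> * c * n) \<le> 2 * pi * \<bar>C\<bar> / R"
        using eventually_gt_at_top[of 0] eventually_ge_at_top[of R1] eventually_ge_at_top[of R0]
        by eventually_elim (rule key)
    qed auto
    then show ?thesis by (simp add: n_def)
  qed
qed

text \<open>Each boundary curve contributes \<open>2 * pi * \<i> * c\<close> times its winding
  number about one common point \<open>w\<close> of \<open>D\<close>, and these numbers add up to
  \<open>1\<close>. Outer curves and boundaries of holes are thus treated alike.\<close>

lemma residue_at_infinity_boundary:
  assumes D: "open D" "connected D" "D \<noteq> {}"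
    and \<Gamma>: "\<And>\<gamma>. \<gamma> \<in> set \<Gamma> \<Longrightarrow> valid_path \<gamma> \<and> simple_path \<gamma> \<and> pathfinish \<gamma> = pathstart \<gamma>"
    and frontier: "frontier D = (\<Union>\<gamma>\<in>set \<Gamma>. path_image \<gamma>)"
    and one: "\<And>z. z \<in> D \<Longrightarrow> (\<Sum>\<gamma>\<leftarrow>\<Gamma>. winding_number \<gamma> z) = 1"
    and S: "open S" "- D \<subseteq> S" and f: "f holomorphic_on S"
    and bound: "\<And>z. z \<in> S \<Longrightarrow> R0 \<le> norm z \<Longrightarrow> norm (z * f z - c) \<le> C / norm z"
  shows "(\<Sum>\<gamma>\<leftarrow>\<Gamma>. contour_integral \<gamma> f) = 2 * pi * \<i> * c"
proof -
  from D obtain w where w: "w \<in> D" by blast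
  have "frontier D \<inter> D = {}" using D(1) frontier_disjoint_eq by blast
  then have "contour_integral \<gamma> f = 2 * pi * \<i> * c * winding_number \<gamma> w" if "\<gamma> \<in> set \<Gamma>" for \<gamma>
    using \<Gamma>[OF that] frontier that
    by (intro Jordan_curve_residue_at_infinity[OF D _ _ _ _ S f bound w]) auto
  then have "(\<Sum>\<gamma>\<leftarrow>\<Gamma>. contour_integral \<gamma> f) = (\<Sum>\<gamma>\<leftarrow>\<Gamma>. 2 * pi * \<i> * c * winding_number \<gamma> w)"
    by (intro arg_cong[where f=sum_list] map_cong refl)
  also have "\<dots> = 2 * pi * \<i> * c"
    using one[OF w] by (simp add: sum_list_const_mult)
  finally show ?thesis .
qed

section \<open>Quaternionic Hilbert spaces\<close>

lemmas quat_defs = quat_eq_iff zero_quat_def one_quat_def plus_quat_def minus_quat_def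
  uminus_quat_def times_quat_def scaleR_quat_def qcnj_def inner_quat_def

lemma qcnj_simps [simp]:
  "qcnj (p * q) = qcnj q * qcnj p" "qcnj (p + q) = qcnj p + qcnj q" "qcnj (qcnj p) = p"
  "qcnj (of_real r) = of_real r"
  by (simp_all add: quat_defs of_real_def algebra_simps)

lemma qRe_of_real [simp]: "qRe (of_real r) = r"
  by (simp add: of_real_def quat_defs)

lemma qRe_scaleR [simp]: "qRe (r *\<^sub>R p) = r * qRe p"
  by (simp add: quat_defs)

lemma qRe_add [simp]: "qRe (p + q) = qRe p + qRe q"
  by (simp add: quat_defs)

lemma quat_of_real_mult: "of_real r * (p::quat) = r *\<^sub>R p" "p * of_real r = r *\<^sub>R p"
  by (simp_all add: of_real_def)

lemma qcnj_mult_norm: "qcnj q * q = of_real ((norm q)\<^sup>2)" "q * qcnj q = of_real ((norm q)\<^sup>2)"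
  by (simp_all add: qcnj_mult_self power2_norm_eq_inner)

context right_quaternionic_hilbert_space
begin

lemma qscale_zero_right [simp]: "f \<cdot> 0 = 0"
  using qscale_add_right[of f 0 0] by simp

lemma qscale_zero_left [simp]: "0 \<cdot> q = 0"
  using qscale_add_left[of 0 0 q] by simp

lemma qscale_minus_left: "(- f) \<cdot> q = - (f \<cdot> q)"
  using qscale_add_left[of f "- f" q] by (simp add: eq_neg_iff_add_eq_0 add.commute)

lemma qscale_minus_right: "f \<cdot> (- q) = - (f \<cdot> q)"
  using qscale_add_right[of f q "- q"] by (simp add: eq_neg_iff_add_eq_0 add.commute)

lemma qscale_diff_left: "(f - g) \<cdot> q = f \<cdot> q - g \<cdot> q"
  using qscale_add_left[of f "- g" q] by (simp add: qscale_minus_left)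

lemma qscale_diff_right: "f \<cdot> (p - q) = f \<cdot> p - f \<cdot> q"
  using qscale_add_right[of f p "- q"] by (simp add: qscale_minus_right)

lemma qscale_of_real [simp]: "f \<cdot> of_real r = r *\<^sub>R f"
  by (simp add: scaleR_eq_qscale)

lemma qscale_scaleR_left: "(r *\<^sub>R f) \<cdot> q = r *\<^sub>R (f \<cdot> q)"
  by (simp add: scaleR_eq_qscale qscale_qscale quat_of_real_mult del: qscale_of_real)

lemma qscale_scaleR_right: "f \<cdot> (r *\<^sub>R q) = r *\<^sub>R (f \<cdot> q)"
  by (simp add: scaleR_eq_qscale qscale_qscale quat_of_real_mult
      del: qscale_of_real)

lemma qinner_add_right: "qinner f (g + h) = qinner f g + qinner f h"
  using qinner_right[of f g 1 h] by (simp add: qscale_one)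

lemma qinner_zero_right [simp]: "qinner f 0 = 0"
  using qinner_add_right[of f 0 0] by simp

lemma qinner_zero_left [simp]: "qinner 0 f = 0"
  by (subst qinner_commute) (simp add: qcnj_def zero_quat_def[symmetric], simp add: zero_quat_def)

lemma qinner_qscale_right: "qinner f (g \<cdot> q) = qinner f g * q"
  using qinner_right[of f g q 0] by simp

lemma qinner_add_left: "qinner (f + g) h = qinner f h + qinner g h"
  by (metis qcnj_simps(2) qinner_add_right qinner_commute)

lemma qinner_qscale_left: "qinner (f \<cdot> q) g = qcnj q * qinner f g"
  by (metis qcnj_simps(1) qinner_qscale_right qinner_commute)

lemma qinner_scaleR_right: "qinner f (r *\<^sub>R g) = r *\<^sub>R qinner f g"
  by (simp add: scaleR_eq_qscale qinner_qscale_right quat_of_real_mult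
      del: qscale_of_real)

lemma qinner_scaleR_left: "qinner (r *\<^sub>R f) g = r *\<^sub>R qinner f g"
  by (simp add: scaleR_eq_qscale qinner_qscale_left quat_of_real_mult del: qscale_of_real)

lemma qinner_diff_left: "qinner (f - g) h = qinner f h - qinner g h"
  using qinner_add_left[of "f - g" g h] by simp

lemma qinner_diff_right: "qinner h (f - g) = qinner h f - qinner h g"
  using qinner_add_right[of h "f - g" g] by simp

lemma qinner_sum_right: "qinner f (\<Sum>x\<in>A. g x) = (\<Sum>x\<in>A. qinner f (g x))"
  by (induction A rule: infinite_finite_induct) (simp_all add: qinner_add_right)

lemma qinner_sum_left: "qinner (\<Sum>x\<in>A. g x) f = (\<Sum>x\<in>A. qinner (g x) f)"
  by (induction A rule: infinite_finite_induct) (simp_all add: qinner_add_left)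

lemma norm_squared_qinner: "(norm f)\<^sup>2 = qRe (qinner f f)"
  by (simp add: norm_eq_qinner qinner_self(2))

lemma qinner_self_norm: "qinner f f = of_real ((norm f)\<^sup>2)"
  using qinner_self(1)[of f] by (simp add: norm_squared_qinner)

lemma norm_qscale: "norm (f \<cdot> q) = norm f * norm q"
proof -
  have "(norm (f \<cdot> q))\<^sup>2 = qRe (qcnj q * (qinner f f * q))"
    by (simp add: norm_squared_qinner qinner_qscale_left qinner_qscale_right mult.assoc)
  also have "\<dots> = (norm f)\<^sup>2 * qRe (qcnj q * q)"
    by (simp add: qinner_self_norm quat_of_real_mult del: of_real_power)
  also have "\<dots> = (norm f * norm q)\<^sup>2"
    by (simp only: qcnj_mult_norm power_mult_distrib qRe_of_real)
  finally show ?thesis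
    by (simp add: power2_eq_iff_nonneg)
qed

lemma qRe_qinner_le: "qRe (qinner f g) \<le> norm f * norm g"
proof -
  have comm: "qRe (qinner g f) = qRe (qinner f g)"
    by (subst qinner_commute) (simp add: qcnj_def)
  \<comment> \<open>Both terms have length \<open>norm f * norm g\<close>, so nonnegativity of the
    squared norm becomes the Cauchy-Schwarz inequality for real parts.\<close>
  let ?v = "norm g *\<^sub>R f - norm f *\<^sub>R g"
  have "0 \<le> (norm ?v)\<^sup>2" by simp
  also have "(norm ?v)\<^sup>2 = 2 * (norm f)\<^sup>2 * (norm g)\<^sup>2 - 2 * (norm f * norm g) * qRe (qinner f g)"
    unfolding norm_squared_qinner
    by (simp add: qinner_diff_left qinner_diff_right qinner_scaleR_left qinner_scaleR_right
        minus_quat_def scaleR_quat_def comm norm_squared_qinner[symmetric] power2_eq_square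
        algebra_simps)
  finally have *: "(norm f * norm g) * qRe (qinner f g) \<le> (norm f * norm g) * (norm f * norm g)"
    by (simp add: power2_eq_square algebra_simps)
  show ?thesis
  proof (cases "f = 0 \<or> g = 0")
    case False
    then show ?thesis using * by (subst (asm) mult_le_cancel_left_pos) auto
  qed (auto simp: zero_quat_def)
qed

lemma norm_qinner_le: "norm (qinner f g) \<le> norm f * norm g"
proof (cases "qinner f g = 0")
  case False
  let ?q = "qinner f g"
  \<comment> \<open>Replacing \<open>f\<close> by \<open>f \<cdot> ?q\<close> makes the inner
    product real, so the bound for real parts suffices.\<close>
  have "(norm ?q)\<^sup>2 = qRe (qinner (f \<cdot> ?q) g)"
    by (simp only: qinner_qscale_left qcnj_mult_norm qRe_of_real)
  also have "\<dots> \<le> norm ?q * (norm f * norm g)"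
    using qRe_qinner_le[of "f \<cdot> ?q" g] by (simp add: norm_qscale mult_ac)
  finally show ?thesis
    using False by (simp add: power2_eq_square)
qed simp

end

lemma bounded_bilinear_qscale:
  "bounded_bilinear (qscale :: 'v::right_quaternionic_hilbert_space \<Rightarrow> _)"
  by (rule bounded_bilinear.intro)
    (auto simp: qscale_add_left qscale_add_right qscale_scaleR_left qscale_scaleR_right norm_qscale
      intro: exI[of _ 1])

lemma bounded_bilinear_qinner:
  "bounded_bilinear (qinner :: 'v::right_quaternionic_hilbert_space \<Rightarrow> _)"
  by (rule bounded_bilinear.intro)
    (auto simp: qinner_add_left qinner_add_right qinner_scaleR_left qinner_scaleR_right
      intro!: exI[of _ 1] norm_qinner_le)

lemmas bounded_linear_qscale_left = bounded_bilinear.bounded_linear_left[OF bounded_bilinear_qscale]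
lemmas bounded_linear_qinner_right = bounded_bilinear.bounded_linear_right[OF bounded_bilinear_qinner]


section \<open>Hilbert bases and the induced left multiplication\<close>

lemma hilbert_basis_qinner:
  "hilbert_basis N \<Longrightarrow> g \<in> N \<Longrightarrow> h \<in> N \<Longrightarrow> qinner g h = (if g = h then 1 else 0)"
  by (simp add: hilbert_basis_def)

lemma qinner_basis_sum:
  assumes N: "hilbert_basis N" and F: "finite F" "F \<subseteq> N" and g: "g \<in> N"
  shows "qinner g (\<Sum>h\<in>F. h \<cdot> c h) = (if g \<in> F then c g else 0)"
proof -
  have "qinner g (\<Sum>h\<in>F. h \<cdot> c h) = (\<Sum>h\<in>F. if g = h then c h else 0)"
    unfolding qinner_sum_right qinner_qscale_right
    using F g by (intro sum.cong refl) (auto simp: hilbert_basis_qinner[OF N])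
  then show ?thesis using F by simp
qed

lemma norm_basis_sum:
  assumes N: "hilbert_basis N" and F: "finite F" "F \<subseteq> N"
  shows "(norm (\<Sum>g\<in>F. g \<cdot> c g))\<^sup>2 = (\<Sum>g\<in>F. (norm (c g))\<^sup>2)"
proof -
  have "qinner (\<Sum>g\<in>F. g \<cdot> c g) (\<Sum>h\<in>F. h \<cdot> c h)
      = (\<Sum>g\<in>F. qcnj (c g) * qinner g (\<Sum>h\<in>F. h \<cdot> c h))"
    by (simp only: qinner_sum_left qinner_qscale_left)
  also have "\<dots> = (\<Sum>g\<in>F. of_real ((norm (c g))\<^sup>2))"
    using F by (intro sum.cong refl) (auto simp: qinner_basis_sum[OF N F] qcnj_mult_norm)
  finally show ?thesis
    by (simp only: norm_squared_qinner of_real_sum[symmetric] qRe_of_real)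
qed

text \<open>The sum \<open>?s\<close> is the orthogonal projection of \<open>f\<close> onto the span
  of \<open>F\<close>: its inner products with \<open>f\<close> and with itself coincide, so the
  difference of the two sides is the squared norm of \<open>f - ?s\<close>.\<close>

lemma Bessel_inequality:
  assumes N: "hilbert_basis N" and F: "finite F" "F \<subseteq> N"
  shows "(\<Sum>g\<in>F. (norm (qinner g f))\<^sup>2) \<le> (norm f)\<^sup>2"
proof -
  let ?s = "\<Sum>g\<in>F. g \<cdot> qinner g f"
  have 1: "qinner ?s f = of_real (\<Sum>g\<in>F. (norm (qinner g f))\<^sup>2)"
    by (simp add: qinner_sum_left qinner_qscale_left qcnj_mult_norm)
  then have 2: "qinner f ?s = of_real (\<Sum>g\<in>F. (norm (qinner g f))\<^sup>2)"
    by (subst qinner_commute) (simp only: qcnj_simps)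
  have 3: "qinner ?s ?s = of_real (\<Sum>g\<in>F. (norm (qinner g f))\<^sup>2)"
    by (simp only: qinner_self_norm norm_basis_sum[OF N F])
  have "qinner (f - ?s) (f - ?s) = of_real ((norm f)\<^sup>2 - (\<Sum>g\<in>F. (norm (qinner g f))\<^sup>2))"
    by (simp only: qinner_diff_left qinner_diff_right 1 2 3 qinner_self_norm[of f] of_real_diff) simp
  then have "(norm (f - ?s))\<^sup>2 = (norm f)\<^sup>2 - (\<Sum>g\<in>F. (norm (qinner g f))\<^sup>2)"
    by (simp only: norm_squared_qinner[of "f - ?s"] qRe_of_real)
  then show ?thesis
    using zero_le_power2[of "norm (f - ?s)"] by linarith
qed

lemma norm_left_mult_sum_le:
  assumes N: "hilbert_basis N" and F: "finite F" "F \<subseteq> N"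
  shows "norm (\<Sum>g\<in>F. g \<cdot> (q * qinner g f)) \<le> norm q * norm f"
proof -
  have "(norm (\<Sum>g\<in>F. g \<cdot> (q * qinner g f)))\<^sup>2 = (norm q)\<^sup>2 * (\<Sum>g\<in>F. (norm (qinner g f))\<^sup>2)"
    by (simp add: norm_basis_sum[OF N F] norm_mult power_mult_distrib sum_distrib_left)
  also have "\<dots> \<le> (norm q * norm f)\<^sup>2"
    unfolding power_mult_distrib by (intro mult_left_mono Bessel_inequality[OF N F]) auto
  finally show ?thesis by (rule power2_le_imp_le) auto
qed

text \<open>A finite combination \<open>h\<close> near \<open>f\<close> exists by density. Once
  \<open>F\<close> contains the support \<open>B\<close> of \<open>h\<close>, the partial sum for
  \<open>h\<close> no longer depends on \<open>F\<close>, and the partial sum for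
  \<open>f - h\<close> is small uniformly in \<open>F\<close>. This gives both convergence of the
  series and, for \<open>q = 1\<close>, its value.\<close>

lemma left_mult_sum_approx:
  assumes N: "hilbert_basis N" and e: "e > 0"
  obtains B c where "finite B" "B \<subseteq> N" "norm (f - (\<Sum>g\<in>B. g \<cdot> c g)) < e"
    "\<And>F. finite F \<Longrightarrow> F \<subseteq> N \<Longrightarrow> B \<subseteq> F \<Longrightarrow>
       norm ((\<Sum>g\<in>F. g \<cdot> (q * qinner g f)) - (\<Sum>g\<in>B. g \<cdot> (q * c g))) \<le> norm q * e"
proof -
  have "f \<in> closure (qspan N)" using N by (simp add: hilbert_basis_def)
  then obtain h where "h \<in> qspan N" and h: "norm (f - h) < e"
    using e by (metis closure_approachable dist_commute dist_norm)
  then obtain B c where B: "finite B" "B \<subseteq> N" "h = (\<Sum>g\<in>B. g \<cdot> c g)"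
    by (auto simp: qspan_def)
  show thesis
  proof
    fix F assume F: "finite F" "F \<subseteq> N" "B \<subseteq> F"
    have "(\<Sum>g\<in>B. g \<cdot> (q * c g)) = (\<Sum>g\<in>F. g \<cdot> (q * qinner g h))"
      using F by (intro sum.mono_neutral_cong_left)
        (auto simp: B(3) qinner_basis_sum[OF N B(1,2)] subset_iff)
    then have "(\<Sum>g\<in>F. g \<cdot> (q * qinner g f)) - (\<Sum>g\<in>B. g \<cdot> (q * c g))
        = (\<Sum>g\<in>F. g \<cdot> (q * qinner g (f - h)))"
      by (simp add: sum_subtractf[symmetric] qinner_diff_right right_diff_distrib qscale_diff_right)
    also have "norm \<dots> \<le> norm q * norm (f - h)"
      by (rule norm_left_mult_sum_le[OF N F(1,2)])
    also have "\<dots> \<le> norm q * e"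
      using h by (intro mult_left_mono) auto
    finally show "norm ((\<Sum>g\<in>F. g \<cdot> (q * qinner g f)) - (\<Sum>g\<in>B. g \<cdot> (q * c g))) \<le> norm q * e" .
  qed (use B h in auto)
qed

lemma left_mult_summable:
  assumes N: "hilbert_basis N"
  shows "(\<lambda>g. g \<cdot> (q * qinner g f)) summable_on N"
proof -
  let ?S = "sum (\<lambda>g. g \<cdot> (q * qinner g f))"
  have "cauchy_filter (filtermap ?S (finite_subsets_at_top N))"
    unfolding cauchy_filter_metric_filtermap
  proof (intro allI impI)
    fix e :: real assume e: "e > 0"
    \<comment> \<open>Two partial sums are compared through the fixed sum over \<open>B\<close>, at
      a cost of \<open>norm q * d\<close> each; the summand \<open>1\<close> keeps the denominator
      positive when \<open>q = 0\<close>.\<close>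
    define d where "d = e / (2 * norm q + 1)"
    have d: "d > 0" "2 * (norm q * d) < e"
      using e by (auto simp: d_def field_simps add_pos_nonneg)
    obtain B c where B: "finite B" "B \<subseteq> N" and
      app: "\<And>F. finite F \<Longrightarrow> F \<subseteq> N \<Longrightarrow> B \<subseteq> F \<Longrightarrow>
        norm (?S F - (\<Sum>g\<in>B. g \<cdot> (q * c g))) \<le> norm q * d"
      by (rule left_mult_sum_approx[OF N d(1), of f q]) blast
    have "dist (?S F) (?S F') < e"
      if "finite F" "B \<subseteq> F" "F \<subseteq> N" "finite F'" "B \<subseteq> F'" "F' \<subseteq> N" for F F'
      using app[of F] app[of F'] that d(2)
      by (intro le_less_trans[OF dist_triangle2[of _ _ "\<Sum>g\<in>B. g \<cdot> (q * c g)"]])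
        (auto simp: dist_norm)
    moreover have "\<forall>\<^sub>F F in finite_subsets_at_top N. finite F \<and> B \<subseteq> F \<and> F \<subseteq> N"
      using B by (auto simp: eventually_finite_subsets_at_top)
    ultimately show "\<exists>P. eventually P (finite_subsets_at_top N) \<and>
        (\<forall>x y. P x \<and> P y \<longrightarrow> dist (?S x) (?S y) < e)"
      by (intro exI[of _ "\<lambda>F. finite F \<and> B \<subseteq> F \<and> F \<subseteq> N"]) auto
  qed
  then have "convergent_filter (filtermap ?S (finite_subsets_at_top N))"
    by (rule cauchy_filter_convergent)
  then show ?thesis
    by (auto simp: convergent_filter.simps filterlim_def summable_on_def has_sum_def)
qed

text \<open>This justifies the use of \<open>Blinfun\<close> in \<open>left_mult\<close>: the
  operator applied to \<open>f\<close> is the value of the series. The norm bound passes to the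
  limit from the finite partial sums.\<close>

lemma bounded_linear_left_mult:
  assumes N: "hilbert_basis N"
  shows "bounded_linear (\<lambda>f. \<Sum>\<^sub>\<infinity>g\<in>N. g \<cdot> (q * qinner g f))"
proof (rule bounded_linear_intro)
  fix f h and r :: real
  note sum = left_mult_summable[OF N]
  show "(\<Sum>\<^sub>\<infinity>g\<in>N. g \<cdot> (q * qinner g (f + h)))
      = (\<Sum>\<^sub>\<infinity>g\<in>N. g \<cdot> (q * qinner g f)) + (\<Sum>\<^sub>\<infinity>g\<in>N. g \<cdot> (q * qinner g h))"
    by (subst infsum_add[OF sum sum, symmetric])
      (simp add: qinner_add_right distrib_left qscale_add_right)
  show "(\<Sum>\<^sub>\<infinity>g\<in>N. g \<cdot> (q * qinner g (r *\<^sub>R f))) = r *\<^sub>R (\<Sum>\<^sub>\<infinity>g\<in>N. g \<cdot> (q * qinner g f))"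
    by (simp add: qinner_scaleR_right qscale_scaleR_right infsum_scaleR_right)
  show "norm (\<Sum>\<^sub>\<infinity>g\<in>N. g \<cdot> (q * qinner g f)) \<le> norm f * norm q"
  proof (rule tendsto_upperbound)
    show "((\<lambda>F. norm (\<Sum>g\<in>F. g \<cdot> (q * qinner g f))) \<longlongrightarrow> norm (\<Sum>\<^sub>\<infinity>g\<in>N. g \<cdot> (q * qinner g f)))
        (finite_subsets_at_top N)"
      by (intro tendsto_norm infsum_tendsto sum)
    show "\<forall>\<^sub>F F in finite_subsets_at_top N. norm (\<Sum>g\<in>F. g \<cdot> (q * qinner g f)) \<le> norm f * norm q"
      using norm_left_mult_sum_le[OF N]
      by (intro eventually_finite_subsets_at_top_weakI) (simp add: mult.commute)
  qed simp
qed

lemma left_mult_has_sum: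
  assumes N: "hilbert_basis N"
  shows "((\<lambda>g. g \<cdot> (q * qinner g f)) has_sum left_mult N q f) N"
  using left_mult_summable[OF N]
  by (simp add: left_mult_def bounded_linear_Blinfun_apply[OF bounded_linear_left_mult[OF N]])

lemma left_mult_apply_eqI:
  assumes N: "hilbert_basis N" and "((\<lambda>g. g \<cdot> (q * qinner g f)) has_sum h) N"
  shows "left_mult N q f = h"
  using has_sum_unique[OF left_mult_has_sum[OF N] assms(2)] .

lemma left_mult_one:
  assumes N: "hilbert_basis N"
  shows "left_mult N 1 = id_blinfun"
proof (rule blinfun_eqI)
  fix f
  have "((\<lambda>g. g \<cdot> (1 * qinner g f)) has_sum f) N"
    unfolding has_sum_def
  proof (rule tendstoI)
    fix e :: real assume e: "e > 0"
    \<comment> \<open>The same finite combination is within \<open>e / 2\<close> of \<open>f\<close>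
      and of all sufficiently large partial sums.\<close>
    obtain B c where B: "finite B" "B \<subseteq> N" "norm (f - (\<Sum>g\<in>B. g \<cdot> c g)) < e / 2" and
      app: "\<And>F. finite F \<Longrightarrow> F \<subseteq> N \<Longrightarrow> B \<subseteq> F \<Longrightarrow>
        norm ((\<Sum>g\<in>F. g \<cdot> (1 * qinner g f)) - (\<Sum>g\<in>B. g \<cdot> (1 * c g))) \<le> norm (1::quat) * (e/2)"
      by (rule left_mult_sum_approx[OF N half_gt_zero[OF e], of f 1]) blast
    have "dist (\<Sum>g\<in>F. g \<cdot> (1 * qinner g f)) f < e" if "finite F" "B \<subseteq> F" "F \<subseteq> N" for F
      using app[of F] B(3) that
      by (intro le_less_trans[OF dist_triangle2[of _ _ "\<Sum>g\<in>B. g \<cdot> c g"]]) (auto simp: dist_norm)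
    moreover have "\<forall>\<^sub>F F in finite_subsets_at_top N. finite F \<and> B \<subseteq> F \<and> F \<subseteq> N"
      using B by (auto simp: eventually_finite_subsets_at_top)
    ultimately show "\<forall>\<^sub>F F in finite_subsets_at_top N. dist (\<Sum>g\<in>F. g \<cdot> (1 * qinner g f)) f < e"
      by (auto elim: eventually_mono)
  qed
  then show "left_mult N 1 f = id_blinfun f"
    by (simp only: left_mult_apply_eqI[OF N] id_blinfun.rep_eq)
qed

lemma left_mult_add:
  assumes N: "hilbert_basis N"
  shows "left_mult N (p + q) = left_mult N p + left_mult N q"
  using has_sum_add[OF left_mult_has_sum[OF N] left_mult_has_sum[OF N]]
  by (intro blinfun_eqI left_mult_apply_eqI[OF N])
    (simp add: distrib_right qscale_add_right blinfun.add_left)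

lemma left_mult_scaleR:
  assumes N: "hilbert_basis N"
  shows "left_mult N (r *\<^sub>R q) = r *\<^sub>R left_mult N q"
  using has_sum_bounded_linear[OF bounded_linear_scaleR_right left_mult_has_sum[OF N]]
  by (intro blinfun_eqI left_mult_apply_eqI[OF N])
    (simp add: qscale_scaleR_right blinfun.scaleR_left)

lemma left_mult_mult:
  assumes N: "hilbert_basis N"
  shows "left_mult N (p * q) = left_mult N p o\<^sub>L left_mult N q"
proof (rule blinfun_eqI)
  fix f
  \<comment> \<open>Left multiplication acts on the basis coefficients by \<open>q\<close>; applying
    it twice therefore multiplies them by \<open>p * q\<close>.\<close>
  have coeff: "qinner g (left_mult N q f) = q * qinner g f" if g: "g \<in> N" for g
  proof (rule has_sum_unique)
    show "((\<lambda>h. qinner g (h \<cdot> (q * qinner h f))) has_sum qinner g (left_mult N q f)) N"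
      by (rule has_sum_bounded_linear[OF bounded_linear_qinner_right left_mult_has_sum[OF N]])
    show "((\<lambda>h. qinner g (h \<cdot> (q * qinner h f))) has_sum q * qinner g f) N"
    proof (rule has_sum_finite_neutralI[of "{g}"])
      show "qinner g (h \<cdot> (q * qinner h f)) = 0" if "h \<in> N - {g}" for h
        using g that hilbert_basis_qinner[OF N g, of h] by (auto simp: qinner_qscale_right)
      show "q * qinner g f = (\<Sum>h\<in>{g}. qinner g (h \<cdot> (q * qinner h f)))"
        using hilbert_basis_qinner[OF N g g] by (simp add: qinner_qscale_right)
    qed (use g in auto)
  qed
  have "g \<cdot> (p * q * qinner g f) = g \<cdot> (p * qinner g (left_mult N q f))" if "g \<in> N" for g
    by (simp only: coeff[OF that] mult.assoc)
  then have "((\<lambda>g. g \<cdot> (p * q * qinner g f)) has_sum left_mult N p (left_mult N q f)) N"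
    using left_mult_has_sum[OF N, of p "left_mult N q f"] by (subst has_sum_cong)
  then show "left_mult N (p * q) f = (left_mult N p o\<^sub>L left_mult N q) f"
    by (simp only: left_mult_apply_eqI[OF N] blinfun_apply_blinfun_compose)
qed

section \<open>Resolvents relative to an idempotent\<close>

text \<open>This copy of the complex numbers is fixed once and for all and is unrelated to the slice
  \<open>I\<close> over which the Riesz projection is integrated.\<close>

definition cquat :: "complex \<Rightarrow> quat" where
  "cquat z = Quat (Re z) (Im z) 0 0"

lemma cquat_simps:
  "cquat (z + w) = cquat z + cquat w" "cquat (z - w) = cquat z - cquat w"
  "cquat (z * w) = cquat z * cquat w" "cquat (r *\<^sub>R z) = r *\<^sub>R cquat z"
  "cquat 0 = 0" "cquat 1 = 1" "cquat (of_real r) = of_real r"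
  by (simp_all add: cquat_def quat_defs of_real_def)

lemma norm_cquat [simp]: "norm (cquat z) = norm z"
  by (simp add: cquat_def norm_quat_def inner_quat_def cmod_def power2_eq_square)

definition cmul :: "complex \<Rightarrow> 'v::right_quaternionic_hilbert_space \<Rightarrow>\<^sub>L 'v" where
  "cmul z = Blinfun (\<lambda>f. f \<cdot> cquat z)"

lemma cmul_apply [simp]: "cmul z f = f \<cdot> cquat z"
  by (simp add: cmul_def bounded_linear_Blinfun_apply bounded_linear_qscale_left)

lemma norm_cmul_le: "norm (cmul z) \<le> norm z"
  by (rule norm_blinfun_bound) (simp_all add: norm_qscale mult.commute)

lemma bounded_linear_cmul: "bounded_linear cmul"
  by (rule bounded_linear_intro[where K = 1])
    (auto intro!: blinfun_eqI norm_cmul_le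
      simp: cquat_simps qscale_add_right qscale_scaleR_right blinfun.bilinear_simps)

lemma qscale_cquat_commute: "f \<cdot> cquat z \<cdot> cquat w = f \<cdot> cquat w \<cdot> cquat z"
  by (simp only: qscale_qscale cquat_simps(3)[symmetric] mult.commute)

text \<open>Writing \<open>qinner h v\<close> as \<open>a + j b\<close> with \<open>a\<close> and
  \<open>b\<close> in the range of \<open>cquat\<close>, this is \<open>a\<close>. Right
  multiplication by \<open>cquat z\<close> multiplies both parts by \<open>z\<close>, so the form is
  complex linear in \<open>v\<close>.\<close>

definition complex_form :: "'v::right_quaternionic_hilbert_space \<Rightarrow> 'v \<Rightarrow> complex" where
  "complex_form h v = Complex (qRe (qinner h v)) (qIm1 (qinner h v))"

lemma complex_form_cquat: "complex_form h (v \<cdot> cquat z) = complex_form h v * z"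
  by (simp add: complex_form_def qinner_qscale_right cquat_def times_quat_def complex_eq_iff)

lemma norm_complex_form_le: "norm (complex_form h v) \<le> norm h * norm v"
proof -
  have "norm (complex_form h v) \<le> norm (qinner h v)"
    unfolding complex_form_def cmod_def norm_quat_def inner_quat_def
    by (intro real_sqrt_le_mono) (simp add: power2_eq_square)
  then show ?thesis using norm_qinner_le[of h v] by linarith
qed

lemma bounded_linear_complex_form: "bounded_linear (complex_form h)"
proof (rule bounded_linear_intro)
  show "norm (complex_form h v) \<le> norm v * norm h" for v
    using norm_complex_form_le[of h v] by (simp add: mult.commute)
qed (simp_all add: complex_form_def qinner_add_right qinner_scaleR_right complex_eq_iff
    plus_quat_def scaleR_quat_def)

lemmas complex_form_diff = linear_diff[OF bounded_linear.linear[OF bounded_linear_complex_form]]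
  and tendsto_complex_form = bounded_linear.tendsto[OF bounded_linear_complex_form]

text \<open>The forms separate points: for \<open>h = v - w\<close> the value at
  \<open>v - w\<close> has the squared norm as its real part. Operator identities can therefore be
  checked on scalar matrix coefficients.\<close>

lemma complex_form_eqI:
  assumes "\<And>h. complex_form h v = complex_form h w"
  shows "v = w"
proof -
  have "complex_form (v - w) (v - w) = 0"
    using assms[of "v - w"] by (simp add: complex_form_diff)
  then have "(norm (v - w))\<^sup>2 = 0"
    unfolding norm_squared_qinner by (simp add: complex_form_def complex_eq_iff)
  then show ?thesis by simp
qed

lemma blinfun_complex_form_eqI:
  assumes "\<And>h f. complex_form h (blinfun_apply X f) = complex_form h (blinfun_apply Y f)"
  shows "X = Y"
  by (intro blinfun_eqI complex_form_eqI assms)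

section \<open>Existence, continuity and holomorphy of the relative resolvent\<close>

text \<open>For a commuting idempotent \<open>E\<close>, \<open>G\<close> is the inverse of
  \<open>z - T\<close> on the range of \<open>E\<close> and zero on its kernel, with
  \<open>z\<close> acting from the right. The last two conditions fix \<open>G\<close> uniquely, so
  the choice in \<open>cresolvent\<close> is harmless.\<close>

definition resolvent_at ::
  "('v::right_quaternionic_hilbert_space \<Rightarrow>\<^sub>L 'v) \<Rightarrow> ('v \<Rightarrow>\<^sub>L 'v) \<Rightarrow> complex \<Rightarrow> ('v \<Rightarrow>\<^sub>L 'v) \<Rightarrow> bool" where
  "resolvent_at T E z G \<longleftrightarrow>
     (\<forall>f. G f \<cdot> cquat z - T (G f) = E f) \<and> (\<forall>f. G (f \<cdot> cquat z - T f) = E f) \<and>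
     (\<forall>f. E (G f) = G f) \<and> (\<forall>f. G (E f) = G f)"

definition regular_set ::
  "('v::right_quaternionic_hilbert_space \<Rightarrow>\<^sub>L 'v) \<Rightarrow> ('v \<Rightarrow>\<^sub>L 'v) \<Rightarrow> complex set" where
  "regular_set T E = {z. \<exists>G. resolvent_at T E z G}"

definition cresolvent ::
  "('v::right_quaternionic_hilbert_space \<Rightarrow>\<^sub>L 'v) \<Rightarrow> ('v \<Rightarrow>\<^sub>L 'v) \<Rightarrow> complex \<Rightarrow> 'v \<Rightarrow>\<^sub>L 'v" where
  "cresolvent T E z = (SOME G. resolvent_at T E z G)"

text \<open>Instantiated with \<open>P\<close> and with \<open>id_blinfun - P\<close>; both parts of
  \<open>T\<close> are thus described by operators on the whole space.\<close>

locale commuting_idempotent =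
  fixes T E :: "'v::right_quaternionic_hilbert_space \<Rightarrow>\<^sub>L 'v"
  assumes T_qscale: "T (f \<cdot> q) = T f \<cdot> q"
    and E_qscale: "E (f \<cdot> q) = E f \<cdot> q"
    and E_idem: "E (E f) = E f"
    and commute: "T (E f) = E (T f)"
begin

lemma cresolvent: "z \<in> regular_set T E \<Longrightarrow> resolvent_at T E z (cresolvent T E z)"
  unfolding regular_set_def cresolvent_def by (auto intro: someI)

context
  fixes z G
  assumes G: "resolvent_at T E z G"
begin

lemma resolvent_atD:
  "G f \<cdot> cquat z - T (G f) = E f" "G (f \<cdot> cquat z - T f) = E f" "E (G f) = G f" "G (E f) = G f"
  using G by (simp_all add: resolvent_at_def)

text \<open>Complex scalars commute with \<open>z - T\<close>, hence with its relative inverse.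
  General quaternions need not, as they do not commute with \<open>z\<close>.\<close>

lemma resolvent_at_cquat: "G (f \<cdot> cquat w) = G f \<cdot> cquat w"
proof -
  have "E (f \<cdot> cquat w) = (G f \<cdot> cquat w) \<cdot> cquat z - T (G f \<cdot> cquat w)"
    by (simp only: E_qscale T_qscale resolvent_atD(1)[symmetric, of f] qscale_diff_left
        qscale_cquat_commute[of _ z w])
  then have "G (E (f \<cdot> cquat w)) = E (G f \<cdot> cquat w)"
    by (simp add: resolvent_atD(2))
  then show ?thesis by (simp only: resolvent_atD E_qscale[of "G f"])
qed

lemma resolvent_identity:
  assumes G': "resolvent_at T E w G'"
  shows "G f - G' f = G (G' f) \<cdot> cquat (w - z)"
proof -
  have "G f = G (G' f \<cdot> cquat w - T (G' f))"
    using G' resolvent_atD(4)[of f] by (metis resolvent_at_def)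
  also have "G' f \<cdot> cquat w - T (G' f) = (G' f \<cdot> cquat z - T (G' f)) + G' f \<cdot> cquat (w - z)"
    by (simp add: cquat_simps qscale_diff_right)
  also have "G \<dots> = E (G' f) + G (G' f) \<cdot> cquat (w - z)"
    by (simp only: blinfun.add_right resolvent_atD(2) resolvent_at_cquat)
  also have "E (G' f) = G' f"
    using G' by (simp add: resolvent_at_def)
  finally show ?thesis by simp
qed

text \<open>The Neumann series in fixed-point form: the resolvent at \<open>w\<close> should solve
  \<open>X = G + (z - w) G X\<close>, whose right-hand side is a contraction in \<open>X\<close> on
  the bounded operators.\<close>

lemma regular_near:
  assumes w: "norm G * norm (z - w) < 1"
  shows "w \<in> regular_set T E"
proof -
  define c where "c = cquat (z - w)"
  have small: "norm (G d \<cdot> c) \<le> (norm G * norm (z - w)) * norm d" for d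
    using mult_right_mono[OF norm_blinfun[of G d], of "norm (z - w)"]
    by (simp add: c_def norm_qscale mult_ac)
  \<comment> \<open>Uniqueness for the homogeneous equation. It yields \<open>X (E f) = X f\<close>
    and the left inverse property, by showing that the respective difference solves this
    equation.\<close>
  have zero: "d = 0" if "d = G d \<cdot> c" for d
  proof (rule ccontr)
    assume "d \<noteq> 0"
    then have "(norm G * norm (z - w)) * norm d < 1 * norm d"
      using w by (intro mult_strict_right_mono) auto
    with small[of d] that show False by simp
  qed
  let ?\<Phi> = "\<lambda>X. G + ((cmul (z - w) o\<^sub>L G) o\<^sub>L X)"
  have "\<exists>!X. ?\<Phi> X = X"
  proof (rule banach_fix_type[of "norm G * norm (z - w)"])
    show "\<forall>X Y. dist (?\<Phi> X) (?\<Phi> Y) \<le> norm G * norm (z - w) * dist X Y"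
    proof (intro allI)
      fix X Y :: "'v \<Rightarrow>\<^sub>L 'v"
      have "?\<Phi> X - ?\<Phi> Y = (cmul (z - w) o\<^sub>L G) o\<^sub>L (X - Y)"
        by (rule blinfun_eqI) (simp only: blinfun.add_left blinfun.diff_left blinfun.diff_right
            blinfun_apply_blinfun_compose cmul_apply qscale_diff_left add_diff_cancel_left)
      moreover have "norm ((cmul (z - w) o\<^sub>L G) o\<^sub>L (X - Y)) \<le> norm (cmul (z - w) o\<^sub>L G) * norm (X - Y)"
        by (rule norm_blinfun_compose)
      moreover have "norm (cmul (z - w) o\<^sub>L G) \<le> norm G * norm (z - w)"
        by (rule norm_blinfun_bound) (use small in \<open>auto simp: c_def\<close>)
      ultimately show "dist (?\<Phi> X) (?\<Phi> Y) \<le> norm G * norm (z - w) * dist X Y"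
        unfolding dist_norm by (smt (verit) mult_right_mono norm_ge_zero)
    qed
  qed (use w in auto)
  then obtain X where "?\<Phi> X = X" by blast
  then have X: "X f = G f + G (X f) \<cdot> c" for f
    by (metis blinfun.add_left blinfun_apply_blinfun_compose c_def cmul_apply)
  have EX: "E (X f) = X f" for f
  proof -
    have "E (X f) = E (G f) + E (G (X f)) \<cdot> c"
      by (subst X) (simp add: blinfun.add_right E_qscale)
    also have "\<dots> = X f" by (simp add: resolvent_atD X[symmetric])
    finally show ?thesis .
  qed
  have XE: "X (E f) = X f" for f
  proof -
    have "X (E f) - X f = G (X (E f) - X f) \<cdot> c"
      by (subst (1) X, subst (2) X)
        (simp add: blinfun.diff_right qscale_diff_left resolvent_atD)
    then show ?thesis using zero by force
  qed
  have "X f \<cdot> cquat w - T (X f) = E f" for f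
  proof -
    have "X f \<cdot> cquat z - T (X f)
        = (G f \<cdot> cquat z - T (G f)) + (G (X f) \<cdot> cquat z - T (G (X f))) \<cdot> c"
      by (subst (1) X, subst (2) X)
        (simp add: blinfun.add_right qscale_add_left T_qscale qscale_diff_left c_def
          qscale_cquat_commute[of _ z])
    then have "X f \<cdot> cquat z - T (X f) = E f + X f \<cdot> c"
      by (simp add: resolvent_atD EX)
    then show ?thesis
      by (simp add: c_def cquat_simps qscale_diff_right algebra_simps)
  qed
  moreover have "X (f \<cdot> cquat w - T f) = E f" for f
  proof -
    define g where "g = f \<cdot> cquat w - T f"
    have "g = (f \<cdot> cquat z - T f) - f \<cdot> c"
      by (simp add: g_def c_def cquat_simps qscale_diff_right)
    then have "G g = E f - G f \<cdot> c"
      by (simp only: blinfun.diff_right[of _ "f \<cdot> cquat z - T f"] resolvent_atD(2)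
          resolvent_at_cquat c_def)
    then have "X g - E f = G (X g - E f) \<cdot> c"
      by (subst (1) X) (simp add: blinfun.diff_right qscale_diff_left resolvent_atD(4))
    then show ?thesis using zero unfolding g_def by force
  qed
  ultimately have "resolvent_at T E w X"
    using EX XE by (simp add: resolvent_at_def)
  then show ?thesis by (auto simp: regular_set_def)
qed

end

lemma open_regular_set: "open (regular_set T E)"
  unfolding open_contains_ball
proof
  fix z assume "z \<in> regular_set T E"
  then have G: "resolvent_at T E z (cresolvent T E z)" (is "resolvent_at _ _ _ ?G")
    by (rule cresolvent)
  \<comment> \<open>Adding \<open>1\<close> to the norm keeps the radius meaningful when
    \<open>norm ?G = 0\<close>.\<close>
  have "w \<in> regular_set T E" if "w \<in> ball z (1 / (norm ?G + 1))" for w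
  proof -
    have "norm ?G * dist z w \<le> (norm ?G + 1) * dist z w"
      by (intro mult_right_mono) auto
    also have "\<dots> < 1"
      using that by (simp add: pos_less_divide_eq add_nonneg_pos mult.commute)
    finally show ?thesis
      by (intro regular_near[OF G]) (simp add: dist_norm)
  qed
  then show "\<exists>e>0. ball z e \<subseteq> regular_set T E"
    by (intro exI[of _ "1 / (norm ?G + 1)"]) (auto simp: add_nonneg_pos)
qed

lemma cresolvent_tendsto:
  assumes z: "z \<in> regular_set T E"
  shows "(cresolvent T E \<longlongrightarrow> cresolvent T E z) (at z)"
proof -
  let ?G = "cresolvent T E"
  \<comment> \<open>The resolvent identity bounds the difference in terms of
    \<open>norm (?G w)\<close>, which is not yet controlled. The threshold \<open>1/2\<close> lets
    that term be absorbed, giving \<open>norm (?G w) \<le> 2 * norm (?G z)\<close>.\<close>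
  have *: "norm (?G w - ?G z) \<le> 2 * (norm (?G z))\<^sup>2 * norm (z - w)"
    if w: "w \<in> regular_set T E" "norm (?G z) * norm (z - w) \<le> 1/2" for w
  proof -
    have "norm (?G w - ?G z) \<le> norm (?G w) * norm (?G z) * norm (z - w)"
    proof (rule norm_blinfun_bound)
      fix f
      have "norm ((?G w - ?G z) f) = norm (?G w (?G z f)) * norm (z - w)"
        using resolvent_identity[OF cresolvent[OF w(1)] cresolvent[OF z]]
        by (simp add: blinfun.diff_left norm_qscale)
      also have "\<dots> \<le> (norm (?G w) * (norm (?G z) * norm f)) * norm (z - w)"
        by (intro mult_right_mono order_trans[OF norm_blinfun] mult_left_mono norm_blinfun) auto
      finally show "norm ((?G w - ?G z) f) \<le> norm (?G w) * norm (?G z) * norm (z - w) * norm f"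
        by (simp add: mult_ac)
    qed auto
    also have "\<dots> = norm (?G w) * (norm (?G z) * norm (z - w))" by simp
    finally have 1: "norm (?G w - ?G z) \<le> norm (?G w) * (norm (?G z) * norm (z - w))" .
    also have "\<dots> \<le> norm (?G w) * (1/2)"
      using w by (intro mult_left_mono) auto
    finally have "norm (?G w) \<le> 2 * norm (?G z)"
      using norm_triangle_sub[of "?G w" "?G z"] by simp
    then have "norm (?G w) * (norm (?G z) * norm (z - w)) \<le> 2 * norm (?G z) * (norm (?G z) * norm (z - w))"
      by (intro mult_right_mono) auto
    with 1 show ?thesis by (simp add: power2_eq_square mult_ac)
  qed
  have "((\<lambda>w. ?G w - ?G z) \<longlongrightarrow> 0) (at z)"
  proof (rule Lim_null_comparison)
    have "((\<lambda>w. norm (?G z) * norm (z - w)) \<longlongrightarrow> norm (?G z) * norm (z - z)) (at z)"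
      by (intro tendsto_intros)
    then have "\<forall>\<^sub>F w in at z. norm (?G z) * norm (z - w) < 1/2"
      by (rule order_tendstoD) simp
    moreover have "\<forall>\<^sub>F w in at z. w \<in> regular_set T E"
      using open_regular_set z by (rule eventually_at_in_open')
    ultimately show "\<forall>\<^sub>F w in at z. norm (?G w - ?G z) \<le> 2 * (norm (?G z))\<^sup>2 * norm (z - w)"
      by eventually_elim (auto intro!: *)
    have "((\<lambda>w. 2 * (norm (?G z))\<^sup>2 * norm (z - w)) \<longlongrightarrow> 2 * (norm (?G z))\<^sup>2 * norm (z - z)) (at z)"
      by (intro tendsto_intros)
    then show "((\<lambda>w. 2 * (norm (?G z))\<^sup>2 * norm (z - w)) \<longlongrightarrow> 0) (at z)" by simp
  qed
  then show ?thesis by (simp add: LIM_zero_iff)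
qed

lemma continuous_on_cresolvent: "continuous_on (regular_set T E) (cresolvent T E)"
  by (intro continuous_at_imp_continuous_on ballI)
    (simp add: isCont_def cresolvent_tendsto)

text \<open>By the resolvent identity the difference quotient at \<open>z\<close> is the coefficient
  of \<open>- ?G w (?G z f)\<close>, which converges by continuity of the resolvent.\<close>

lemma cresolvent_holomorphic:
  "(\<lambda>z. complex_form h (cresolvent T E z f)) holomorphic_on regular_set T E"
proof (rule holomorphic_onI, rule field_differentiable_at_within)
  let ?G = "cresolvent T E"
  fix z assume z: "z \<in> regular_set T E"
  have "((\<lambda>w. - complex_form h (?G w (?G z f))) \<longlongrightarrow> - complex_form h (?G z (?G z f))) (at z)"
    by (intro tendsto_intros tendsto_complex_form cresolvent_tendsto z)
  moreover have "\<forall>\<^sub>F w in at z. - complex_form h (?G w (?G z f))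
      = (complex_form h (?G w f) - complex_form h (?G z f)) / (w - z)"
    using eventually_at_in_open'[OF open_regular_set z] eventually_neq_at_within[of z]
  proof eventually_elim
    case (elim w)
    then show ?case
      using resolvent_identity[OF cresolvent[OF elim(1)] cresolvent[OF z], of f]
      by (simp add: complex_form_diff[symmetric] complex_form_cquat field_simps)
  qed
  ultimately have "((\<lambda>w. (complex_form h (?G w f) - complex_form h (?G z f)) / (w - z))
      \<longlongrightarrow> - complex_form h (?G z (?G z f))) (at z)"
    by (rule Lim_transform_eventually)
  then show "(\<lambda>z. complex_form h (?G z f)) field_differentiable at z"
    by (auto simp: field_differentiable_def has_field_derivative_iff)
qed

text \<open>With \<open>?v\<close> the resolvent applied to \<open>f\<close>, the quantity to be
  bounded is the coefficient of \<open>T ?v\<close>. For \<open>norm z\<close> above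
  \<open>2 * norm T\<close> the term \<open>T ?v\<close> is absorbed in
  \<open>?v \<cdot> cquat z - T ?v = E f\<close>, so \<open>?v\<close> itself decays like
  \<open>1 / norm z\<close>.\<close>

lemma cresolvent_asymptotic:
  assumes z: "z \<in> regular_set T E" "2 * norm T + 1 \<le> norm z"
  shows "norm (z * complex_form h (cresolvent T E z f) - complex_form h (E f))
    \<le> 2 * norm h * norm T * norm (E f) / norm z"
proof -
  let ?v = "cresolvent T E z f"
  have eq: "?v \<cdot> cquat z - T ?v = E f"
    using resolvent_atD(1)[OF cresolvent[OF z(1)]] .
  \<comment> \<open>The summand \<open>1\<close> in the lower bound for \<open>norm z\<close>
    excludes \<open>z = 0\<close>.\<close>
  have "norm z > 0" using z(2) norm_ge_zero[of T] by linarith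
  have "norm (?v \<cdot> cquat z) \<le> norm (E f) + norm (T ?v)"
    using norm_triangle_ineq[of "E f" "T ?v"] by (simp add: eq[symmetric])
  then have "norm ?v * norm z \<le> norm (E f) + norm T * norm ?v"
    using norm_blinfun[of T ?v] by (simp add: norm_qscale)
  moreover have "norm ?v * (2 * norm T) \<le> norm ?v * norm z"
    using z(2) by (intro mult_left_mono) auto
  ultimately have "norm ?v * norm z \<le> 2 * norm (E f)"
    by (simp add: mult_ac)
  then have v: "norm ?v \<le> 2 * norm (E f) / norm z"
    using \<open>norm z > 0\<close> by (simp add: field_simps)
  have "z * complex_form h ?v - complex_form h (E f) = complex_form h (T ?v)"
    by (simp add: eq[symmetric] complex_form_diff complex_form_cquat)
  also have "norm \<dots> \<le> norm h * (norm T * norm ?v)"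
    by (intro order_trans[OF norm_complex_form_le] mult_left_mono norm_blinfun) auto
  also have "\<dots> \<le> norm h * (norm T * (2 * norm (E f) / norm z))"
    by (intro mult_left_mono v) auto
  finally show ?thesis by (simp add: mult_ac)
qed

end

section \<open>Path integrals of operator families\<close>

lemma has_integral_complex_form:
  assumes "(\<Phi> has_integral X) A"
  shows "((\<lambda>t. complex_form h (blinfun_apply (\<Phi> t) f)) has_integral complex_form h (X f)) A"
  using has_integral_linear[OF assms
      bounded_linear_compose[OF bounded_linear_complex_form blinfun.bounded_linear_left]]
  by (simp add: o_def)

text \<open>As a function of the endpoint \<open>b\<close> in a disc around \<open>a\<close>, this
  serves as a local primitive of \<open>G\<close>.\<close>

definition op_line_integral ::
  "(complex \<Rightarrow> 'v::right_quaternionic_hilbert_space \<Rightarrow>\<^sub>L 'v) \<Rightarrow> complex \<Rightarrow> complex \<Rightarrow> 'v \<Rightarrow>\<^sub>L 'v" where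
  "op_line_integral G a b = integral {0..1} (\<lambda>s. G (linepath a b s) o\<^sub>L cmul (b - a))"

text \<open>Norm continuity makes segment integrals exist in the operator space, while holomorphy is
  asked only of matrix coefficients, where scalar Cauchy theory applies.\<close>

locale holomorphic_family =
  fixes S :: "complex set" and G :: "complex \<Rightarrow> 'v::right_quaternionic_hilbert_space \<Rightarrow>\<^sub>L 'v"
  assumes open_S: "open S"
    and continuous: "continuous_on S G"
    and holomorphic: "(\<lambda>z. complex_form h (G z f)) holomorphic_on S"
    and cquat: "z \<in> S \<Longrightarrow> G z (f \<cdot> cquat w) = G z f \<cdot> cquat w"
begin

lemma has_integral_op_line_integral:
  assumes "closed_segment a b \<subseteq> S"
  shows "((\<lambda>s. G (linepath a b s) o\<^sub>L cmul (b - a)) has_integral op_line_integral G a b) {0..1}"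
  unfolding op_line_integral_def
proof (intro integrable_integral integrable_continuous_real continuous_intros)
  show "continuous_on {0..1} (\<lambda>s. G (linepath a b s))"
    using assms by (intro continuous_on_compose2[OF continuous] continuous_intros)
      (auto simp: linepath_in_path)
qed

lemma complex_form_compose_cmul:
  "z \<in> S \<Longrightarrow> complex_form h ((G z o\<^sub>L cmul d) f) = complex_form h (G z f) * d"
  by (simp add: cquat complex_form_cquat)

lemma complex_form_op_line_integral:
  assumes ab: "closed_segment a b \<subseteq> S"
  shows "((\<lambda>z. complex_form h (G z f)) has_contour_integral
    complex_form h (op_line_integral G a b f)) (linepath a b)"
proof -
  have "((\<lambda>s. complex_form h ((G (linepath a b s) o\<^sub>L cmul (b - a)) f)) has_integral
      complex_form h (op_line_integral G a b f)) {0..1}"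
    by (rule has_integral_complex_form[OF has_integral_op_line_integral[OF ab]])
  then show ?thesis
    unfolding has_contour_integral_linepath
    by (rule has_integral_eq[rotated])
      (use ab in \<open>simp only: complex_form_compose_cmul subset_iff linepath_in_path\<close>)
qed

text \<open>On a convex set every matrix coefficient has a scalar primitive \<open>p\<close>, so
  each integral becomes a difference of values of \<open>p\<close>.\<close>

lemma op_line_integral_additive:
  assumes B: "convex B" "open B" "B \<subseteq> S" and abc: "a \<in> B" "b \<in> B" "c \<in> B"
  shows "op_line_integral G a c - op_line_integral G a b = op_line_integral G b c"
proof (rule blinfun_complex_form_eqI)
  fix h f
  let ?F = "\<lambda>z. complex_form h (G z f)"
  have "?F holomorphic_on B"
    using holomorphic B(3) by (rule holomorphic_on_subset)
  then obtain p where p: "\<And>z. z \<in> B \<Longrightarrow> (p has_field_derivative ?F z) (at z within B)"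
    using holomorphic_convex_primitive'[OF B(1,2)] by blast
  have "complex_form h (op_line_integral G x y f) = p y - p x" if "x \<in> B" "y \<in> B" for x y
  proof (rule has_contour_integral_unique)
    have seg: "closed_segment x y \<subseteq> B" using that B(1) by (simp add: closed_segment_subset)
    then show "(?F has_contour_integral complex_form h (op_line_integral G x y f)) (linepath x y)"
      using B(3) by (intro complex_form_op_line_integral) auto
    show "(?F has_contour_integral p y - p x) (linepath x y)"
      using contour_integral_primitive[of B p ?F "linepath x y"] p seg by simp
  qed
  then show "complex_form h ((op_line_integral G a c - op_line_integral G a b) f)
      = complex_form h (op_line_integral G b c f)"
    using abc by (simp add: blinfun.diff_left complex_form_diff)
qed

lemma op_line_integral_has_derivative:
  assumes B: "convex B" "open B" "B \<subseteq> S" and a: "a \<in> B" and z: "z \<in> B"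
  shows "(op_line_integral G a has_derivative (\<lambda>d. G z o\<^sub>L cmul d)) (at z)"
  unfolding has_derivative_at_alt
proof (intro conjI allI impI)
  show "bounded_linear (\<lambda>d. G z o\<^sub>L cmul d)"
    by (intro bounded_linear_compose[OF _ bounded_linear_cmul]
        bounded_bilinear.bounded_linear_right[OF bounded_bilinear_blinfun_compose])
  fix e :: real assume e: "e > 0"
  have "isCont G z"
    using continuous_on_interior[OF continuous] open_S B(3) z by (simp add: interior_open subset_iff)
  then obtain d1 where d1: "d1 > 0" "\<And>w. dist w z < d1 \<Longrightarrow> dist (G w) (G z) < e"
    using e by (metis continuous_at_eps_delta)
  obtain d2 where d2: "d2 > 0" "ball z d2 \<subseteq> B"
    using B(2) z by (auto simp: open_contains_ball)
  have "norm (op_line_integral G a y - op_line_integral G a z - (G z o\<^sub>L cmul (y - z))) \<le> e * norm (y - z)"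
    if y: "norm (y - z) < min d1 d2" for y
  proof -
    have yB: "y \<in> B" using y d2 by (auto simp: dist_norm norm_minus_commute subset_iff)
    have seg: "closed_segment z y \<subseteq> S"
      using closed_segment_subset[OF z yB B(1)] B(3) by blast
    \<comment> \<open>By additivity the increment of the primitive is the integral over the segment
      from \<open>z\<close> to \<open>y\<close>; subtracting the constant integrand leaves only the
      oscillation of \<open>G\<close>, which is at most \<open>e\<close> there.\<close>
    have "((\<lambda>s. (G (linepath z y s) o\<^sub>L cmul (y - z)) - (G z o\<^sub>L cmul (y - z))) has_integral
        op_line_integral G z y - (1 - 0) *\<^sub>R (G z o\<^sub>L cmul (y - z))) {0..1}"
      by (intro has_integral_diff has_integral_op_line_integral seg)
        (use has_integral_const_real[of "G z o\<^sub>L cmul (y - z)" 0 1] in simp)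
    then have "norm (op_line_integral G z y - (1 - 0) *\<^sub>R (G z o\<^sub>L cmul (y - z)))
        \<le> (e * norm (y - z)) * measure lborel {0..1::real}"
    proof (rule has_integral_bound_real[rotated 2])
      fix s :: real assume s: "s \<in> {0..1} - {}"
      have "linepath z y s - z = s *\<^sub>R (y - z)"
        by (simp add: linepath_def algebra_simps)
      then have "dist (linepath z y s) z \<le> norm (y - z)"
        using s by (simp add: dist_norm mult_left_le_one_le)
      then have "norm (G (linepath z y s) - G z) \<le> e"
        using d1(2)[of "linepath z y s"] y by (simp add: dist_norm)
      moreover have "(G (linepath z y s) o\<^sub>L cmul (y - z)) - (G z o\<^sub>L cmul (y - z))
          = (G (linepath z y s) - G z) o\<^sub>L cmul (y - z)"
        by (rule blinfun_eqI) (simp add: blinfun.diff_left)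
      ultimately show "norm ((G (linepath z y s) o\<^sub>L cmul (y - z)) - (G z o\<^sub>L cmul (y - z)))
          \<le> e * norm (y - z)"
        using e by (simp only:) (intro order_trans[OF norm_blinfun_compose] mult_mono norm_cmul_le; simp)
    qed (use e in auto)
    then show ?thesis
      using op_line_integral_additive[OF B a z yB] by simp
  qed
  then show "\<exists>d>0. \<forall>y. norm (y - z) < d \<longrightarrow>
      norm (op_line_integral G a y - op_line_integral G a z - (G z o\<^sub>L cmul (y - z))) \<le> e * norm (y - z)"
    using d1 d2 by (intro exI[of _ "min d1 d2"]) auto
qed

text \<open>The derivative of a piecewise \<open>C\<^sup>1\<close> path may be unbounded near the exceptional points, so
  integrability comes from local primitives rather than from continuity of the integrand.\<close>

lemma op_path_integrable:
  assumes \<gamma>: "valid_path \<gamma>" "path_image \<gamma> \<subseteq> S"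
  shows "(\<lambda>t. G (\<gamma> t) o\<^sub>L cmul (vector_derivative \<gamma> (at t within {0..1}))) integrable_on {0..1}"
proof -
  let ?g = "\<lambda>t. G (\<gamma> t) o\<^sub>L cmul (vector_derivative \<gamma> (at t within {0..1}))"
  from \<gamma>(1) obtain k where k: "finite k" "\<gamma> C1_differentiable_on ({0..1} - k)"
      and cont: "continuous_on {0..1} \<gamma>"
    by (auto simp: valid_path_def piecewise_C1_differentiable_on_def)
  have "?g integrable_on cbox 0 1"
  \<comment> \<open>Integrability is local, so it suffices to treat short intervals that
    \<open>\<gamma>\<close> maps into a disc inside \<open>S\<close>, where a primitive
    \<open>?H\<close> exists.\<close>
  proof (rule integrable_on_little_subintervals, intro ballI)
    fix t :: real assume t: "t \<in> cbox 0 1"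
    then have "\<gamma> t \<in> S" using \<gamma>(2) by (auto simp: path_image_def)
    then obtain r where r: "r > 0" "ball (\<gamma> t) r \<subseteq> S"
      using open_S by (auto simp: open_contains_ball)
    obtain d where d: "d > 0" "\<And>s. s \<in> {0..1} \<Longrightarrow> dist s t < d \<Longrightarrow> dist (\<gamma> s) (\<gamma> t) < r"
      using cont t r(1) unfolding continuous_on_iff by (metis cbox_interval)
    have "?g integrable_on cbox u v"
      if uv: "t \<in> cbox u v" "cbox u v \<subseteq> ball t d" "cbox u v \<subseteq> cbox 0 1" for u v
    proof -
      let ?B = "ball (\<gamma> t) r" and ?H = "op_line_integral G (\<gamma> t)"
      have H: "(?H has_derivative (\<lambda>d. G z o\<^sub>L cmul d)) (at z)" if "z \<in> ?B" for z
        using r that by (intro op_line_integral_has_derivative[of ?B]) auto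
      have inB: "\<gamma> s \<in> ?B" if "s \<in> {u..v}" for s
        using d(2)[of s] uv that by (auto simp: subset_iff dist_commute)
      \<comment> \<open>This form of the fundamental theorem asks only for continuity at the
        finitely many exceptional points in \<open>k\<close>.\<close>
      have "(?g has_integral ((?H \<circ> \<gamma>) v - (?H \<circ> \<gamma>) u)) {u..v}"
      proof (rule fundamental_theorem_of_calculus_interior_strong[OF k(1)])
        show "u \<le> v" using uv by auto
        show "continuous_on {u..v} (?H \<circ> \<gamma>)"
        proof (rule continuous_on_compose)
          show "continuous_on {u..v} \<gamma>"
            using cont uv(3) by (auto intro: continuous_on_subset)
          show "continuous_on (\<gamma> ` {u..v}) ?H"
            using inB by (intro continuous_at_imp_continuous_on) (blast intro: has_derivative_continuous[OF H])
        qed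
        fix s assume s: "s \<in> {u<..<v} - k"
        then have s01: "0 < s" "s < 1" "s \<in> {u..v}"
        proof -
          have "u \<in> {0..1}" "v \<in> {0..1}"
            using uv by (auto simp: subset_iff)
          then show "0 < s" "s < 1" "s \<in> {u..v}" using s by auto
        qed
        have "\<gamma> differentiable (at s)"
          using k(2) s s01 by (auto simp: C1_differentiable_on_eq)
        then have \<gamma>': "(\<gamma> has_vector_derivative vector_derivative \<gamma> (at s)) (at s)"
          by (simp add: vector_derivative_works)
        have eq: "vector_derivative \<gamma> (at s within {0..1}) = vector_derivative \<gamma> (at s)"
          using s01 by (intro vector_derivative_at_within_ivl[OF \<gamma>']) auto
        have "(?H \<circ> \<gamma> has_derivative
            (\<lambda>d. G (\<gamma> s) o\<^sub>L cmul d) \<circ> (\<lambda>x. x *\<^sub>R vector_derivative \<gamma> (at s))) (at s)"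
          using \<gamma>' H[OF inB[OF s01(3)]] unfolding has_vector_derivative_def
          by (rule diff_chain_at)
        moreover have "(\<lambda>d. G (\<gamma> s) o\<^sub>L cmul d) \<circ> (\<lambda>x. x *\<^sub>R vector_derivative \<gamma> (at s))
            = (\<lambda>x. x *\<^sub>R (G (\<gamma> s) o\<^sub>L cmul (vector_derivative \<gamma> (at s))))"
          by (intro ext blinfun_eqI)
            (simp add: cquat_simps qscale_scaleR_right blinfun.scaleR_right blinfun.scaleR_left)
        ultimately show "(?H \<circ> \<gamma> has_vector_derivative ?g s) (at s)"
          by (simp add: has_vector_derivative_def eq)
      qed
      then show ?thesis by auto
    qed
    then show "\<exists>d>0. \<forall>u v. t \<in> cbox u v \<and> cbox u v \<subseteq> ball t d \<and> cbox u v \<subseteq> cbox 0 1 \<longrightarrow>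
        ?g integrable_on cbox u v"
      using d(1) by blast
  qed
  then show ?thesis by simp
qed

definition op_path_integral :: "(real \<Rightarrow> complex) \<Rightarrow> 'v \<Rightarrow>\<^sub>L 'v" where
  "op_path_integral \<gamma> =
     integral {0..1} (\<lambda>t. G (\<gamma> t) o\<^sub>L cmul (vector_derivative \<gamma> (at t within {0..1})))"

lemma has_integral_op_path_integral:
  assumes "valid_path \<gamma>" "path_image \<gamma> \<subseteq> S"
  shows "((\<lambda>t. G (\<gamma> t) o\<^sub>L cmul (vector_derivative \<gamma> (at t within {0..1})))
    has_integral op_path_integral \<gamma>) {0..1}"
  unfolding op_path_integral_def by (intro integrable_integral op_path_integrable assms)

lemma complex_form_op_path_integral:
  assumes \<gamma>: "valid_path \<gamma>" "path_image \<gamma> \<subseteq> S"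
  shows "complex_form h (op_path_integral \<gamma> f) = contour_integral \<gamma> (\<lambda>z. complex_form h (G z f))"
proof -
  have "((\<lambda>t. complex_form h ((G (\<gamma> t) o\<^sub>L cmul (vector_derivative \<gamma> (at t within {0..1}))) f))
      has_integral complex_form h (op_path_integral \<gamma> f)) {0..1}"
    by (rule has_integral_complex_form[OF has_integral_op_path_integral[OF \<gamma>]])
  then have "((\<lambda>t. complex_form h (G (\<gamma> t) f) * vector_derivative \<gamma> (at t within {0..1}))
      has_integral complex_form h (op_path_integral \<gamma> f)) {0..1}"
    by (rule has_integral_eq[rotated])
      (use \<gamma>(2) in \<open>simp only: complex_form_compose_cmul path_image_def image_subset_iff\<close>)
  then have "((\<lambda>z. complex_form h (G z f)) has_contour_integral
      complex_form h (op_path_integral \<gamma> f)) \<gamma>"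
    by (simp add: has_contour_integral_def)
  then show ?thesis by (simp add: contour_integral_unique)
qed

end

section \<open>S-resolvents and the Riesz projection\<close>

lemma qcnj_scaleR: "qcnj (r *\<^sub>R q) = r *\<^sub>R qcnj q"
  by (simp add: quat_defs)

lemma imag_unit:
  assumes "I \<in> \<S>"
  shows "qRe I = 0" "I \<bullet> I = 1" "I \<bullet> 1 = 0" "I * I = - 1" "qcnj I = - I"
proof -
  obtain a b c d where I: "I = Quat a b c d" by (cases I)
  have "I * I = - 1" using assms by (simp add: imag_units_def power2_eq_square)
  then have *: "a * a - b * b - c * c - d * d = -1" "a * b = 0" "a * c = 0" "a * d = 0"
    by (auto simp: I quat_defs)
  \<comment> \<open>A nonzero real part would force the imaginary parts to vanish, leaving a real
    square root of \<open>-1\<close>.\<close>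
  have "a = 0"
  proof (rule ccontr)
    assume "a \<noteq> 0"
    then have "a * a = -1" using * by simp
    then show False using zero_le_square[of a] by linarith
  qed
  then show "qRe I = 0" "I \<bullet> I = 1" "I \<bullet> 1 = 0" "I * I = - 1" "qcnj I = - I"
    using * \<open>I * I = - 1\<close> by (simp_all add: I inner_quat_def one_quat_def qcnj_def uminus_quat_def)
qed

context
  fixes I :: quat
  assumes I: "I \<in> \<S>"
begin

lemma slice_emb_simps:
  "slice_emb I (z * w) = slice_emb I z * slice_emb I w"
  "slice_emb I (cnj z) = qcnj (slice_emb I z)"
  "slice_emb I \<i> = I" "slice_emb I (- z) = - slice_emb I z"
proof -
  have "slice_emb I z = Re z *\<^sub>R 1 + Im z *\<^sub>R I" for z
    by (simp add: slice_emb_def of_real_def)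
  then show "slice_emb I (z * w) = slice_emb I z * slice_emb I w"
    by (simp add: imag_unit(4)[OF I] algebra_simps)
qed (simp_all add: slice_emb_def imag_unit(5)[OF I] quat_of_real_mult qcnj_scaleR)

lemma inner_slice_emb: "slice_emb I z \<bullet> 1 = Re z" "I \<bullet> slice_emb I z = Im z"
  by (simp_all add: slice_emb_def quat_of_real_mult of_real_def inner_add_left inner_add_right
      imag_unit[OF I]) (simp_all add: inner_quat_def one_quat_def)

lemma qRe_slice_emb: "qRe (slice_emb I z) = Re z"
  using inner_slice_emb(1)[of z] by (simp add: inner_quat_def one_quat_def)

lemma norm_slice_emb: "norm (slice_emb I z) = norm z"
proof -
  have "slice_emb I z \<bullet> slice_emb I z = (Re z)\<^sup>2 + (Im z)\<^sup>2"
    by (subst (2) slice_emb_def) (simp add: quat_of_real_mult of_real_def inner_add_right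
        inner_slice_emb inner_commute[of _ I] power2_eq_square)
  then show ?thesis by (simp add: norm_quat_def cmod_def)
qed

text \<open>Carries openness, connectedness and the relative frontier in \<open>slice I\<close> over
  to the complex plane; the coordinates are recovered by inner products with \<open>1\<close> and
  \<open>I\<close>.\<close>

lemma homeomorphism_slice_emb:
  "homeomorphism UNIV (slice I) (slice_emb I) (\<lambda>q. Complex (q \<bullet> 1) (I \<bullet> q))"
proof (rule homeomorphismI)
  have "continuous_on UNIV (\<lambda>z. Re z *\<^sub>R (1::quat) + Im z *\<^sub>R I)"
    by (intro continuous_intros)
  then show "continuous_on UNIV (slice_emb I)"
    by (simp add: slice_emb_def[abs_def] of_real_def)
  show "continuous_on (slice I) (\<lambda>q. Complex (q \<bullet> 1) (I \<bullet> q))"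
    unfolding complex_eq by (intro continuous_intros)
qed (auto simp: slice_def inner_slice_emb)

lemma inj_slice_emb: "inj (slice_emb I)"
  using homeomorphism_slice_emb by (metis homeomorphism_apply1 injI iso_tuple_UNIV_I)

lemma slice_emb_vimage: "slice_emb I ` (slice_emb I -` U) = U \<inter> slice I"
  by (auto simp: slice_def)

lemma slice_frontier_eq: "slice_frontier I U = slice_emb I ` frontier (slice_emb I -` U)"
proof -
  have "homeomorphic_map (top_of_set UNIV) (top_of_set (slice I)) (slice_emb I)"
    unfolding homeomorphic_map_maps homeomorphic_maps_def
    using homeomorphism_slice_emb
    by (intro exI[of _ "\<lambda>q. Complex (q \<bullet> 1) (I \<bullet> q)"])
      (auto simp: homeomorphism_def continuous_map_in_subtopology)
  from homeomorphic_map_frontier_of[OF this, of "slice_emb I -` U"] show ?thesis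
    by (simp add: slice_frontier_def slice_emb_vimage del: image_vimage_eq)
qed

lemma slice_preimage:
  assumes "s_domain U"
  shows "open (slice_emb I -` U)" "connected (slice_emb I -` U)" "slice_emb I -` U \<noteq> {}"
proof -
  note hom = homeomorphism_slice_emb
  show "open (slice_emb I -` U)"
    using assms hom by (intro open_vimage) (auto simp: s_domain_def homeomorphism_def)
  have "slice_emb I -` U = (\<lambda>q. Complex (q \<bullet> 1) (I \<bullet> q)) ` (U \<inter> slice I)"
    unfolding slice_emb_vimage[symmetric] image_image by (simp add: inner_slice_emb)
  moreover have "connected ((\<lambda>q. Complex (q \<bullet> 1) (I \<bullet> q)) ` (U \<inter> slice I))"
    using assms hom I
    by (intro connected_continuous_image)
      (auto simp: s_domain_def homeomorphism_def intro: continuous_on_subset)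
  ultimately show "connected (slice_emb I -` U)" by simp
  \<comment> \<open>A real point of \<open>U\<close> lies on every slice, so no slice of
    \<open>U\<close> is empty.\<close>
  from assms obtain r where "of_real r \<in> U" by (auto simp: s_domain_def Reals_def)
  then have "of_real r \<in> slice_emb I -` U" by (simp add: slice_emb_def)
  then show "slice_emb I -` U \<noteq> {}" by blast
qed

end

section \<open>From S-resolvents to complex resolvents\<close>

text \<open>The right-hand side is \<open>(cnj z - T) (z - T) f\<close>. Both
  \<open>z + cnj z\<close> and \<open>z * cnj z\<close> are real and equal the coefficients in
  \<open>Q_op\<close>, whichever \<open>I\<close> is used.\<close>

lemma Q_op_slice_emb:
  fixes T :: "'v::right_quaternionic_hilbert_space \<Rightarrow>\<^sub>L 'v"
  assumes "I \<in> \<S>" and T: "\<And>f q. T (f \<cdot> q) = T f \<cdot> q"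
  shows "Q_op (slice_emb I z) T f
    = (f \<cdot> cquat z - T f) \<cdot> cquat (cnj z) - T (f \<cdot> cquat z - T f)"
proof -
  have "f \<cdot> cquat z \<cdot> cquat (cnj z) = (norm z)\<^sup>2 *\<^sub>R f"
    by (simp only: qscale_qscale cquat_simps(3)[symmetric] complex_norm_square[symmetric]
        cquat_simps(7) qscale_of_real)
  moreover have "T f \<cdot> cquat z + T f \<cdot> cquat (cnj z) = (2 * Re z) *\<^sub>R T f"
    by (simp only: qscale_add_right[symmetric] cquat_simps(1)[symmetric] complex_add_cnj
        cquat_simps(7) qscale_of_real)
  ultimately show ?thesis
    by (simp add: Q_op_def qRe_slice_emb norm_slice_emb assms blinfun.bilinear_simps
        qscale_diff_left algebra_simps)
qed

lemma Q_op_apply: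
  fixes T :: "'v::right_quaternionic_hilbert_space \<Rightarrow>\<^sub>L 'v"
  shows "Q_op q T f = T (T f) - (2 * qRe q) *\<^sub>R T f + (norm q)\<^sup>2 *\<^sub>R f"
  by (simp add: Q_op_def blinfun.bilinear_simps)

lemma Q_op_commute:
  fixes T A :: "'v::right_quaternionic_hilbert_space \<Rightarrow>\<^sub>L 'v"
  assumes "\<And>f. T (A f) = A (T f)"
  shows "Q_op q T (A f) = A (Q_op q T f)"
  by (simp add: Q_op_apply assms blinfun.bilinear_simps)

lemma S_resolvent_set_onE:
  fixes T :: "'v::right_quaternionic_hilbert_space \<Rightarrow>\<^sub>L 'v"
  assumes "q \<in> S_resolvent_set_on W T"
  obtains B K where "\<And>f. f \<in> W \<Longrightarrow> B f \<in> W"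
    and "\<And>f g p. f \<in> W \<Longrightarrow> g \<in> W \<Longrightarrow> B (f \<cdot> p + g) = B f \<cdot> p + B g"
    and "\<And>f. f \<in> W \<Longrightarrow> norm (B f) \<le> K * norm f"
    and "\<And>f. f \<in> W \<Longrightarrow> B (Q_op q T f) = f"
    and "\<And>f. f \<in> W \<Longrightarrow> Q_op q T (B f) = f"
proof -
  from assms obtain B where B: "bounded_right_linear_on W B"
      "\<And>f. f \<in> W \<Longrightarrow> B (Q_op q T f) = f" "\<And>f. f \<in> W \<Longrightarrow> Q_op q T (B f) = f"
    by (auto simp: S_resolvent_set_on_def)
  moreover from B(1) obtain K where "\<And>f. f \<in> W \<Longrightarrow> norm (B f) \<le> K * norm f"
    unfolding bounded_right_linear_on_def by blast
  ultimately show thesis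
    by (intro that[of B K]) (auto simp: bounded_right_linear_on_def)
qed

lemma S_resolvent_setE:
  fixes T :: "'v::right_quaternionic_hilbert_space \<Rightarrow>\<^sub>L 'v"
  assumes "q \<in> \<rho>\<^sub>S T"
  obtains B K where "\<And>f g p. B (f \<cdot> p + g) = B f \<cdot> p + B g" and "\<And>f. norm (B f) \<le> K * norm f"
    and "\<And>f. B (Q_op q T f) = f" and "\<And>f. Q_op q T (B f) = f"
proof -
  obtain B K where "\<And>f g p. f \<in> UNIV \<Longrightarrow> g \<in> UNIV \<Longrightarrow> B (f \<cdot> p + g) = B f \<cdot> p + B g"
    "\<And>f. f \<in> UNIV \<Longrightarrow> norm (B f) \<le> K * norm f"
    "\<And>f. f \<in> UNIV \<Longrightarrow> B (Q_op q T f) = f" "\<And>f. f \<in> UNIV \<Longrightarrow> Q_op q T (B f) = f"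
    by (rule S_resolvent_set_onE[OF assms], rule that)
  then show thesis
    by (intro that[of B K]) (simp_all only: UNIV_I)
qed

context commuting_idempotent
begin

lemma range_E: "f \<in> range E \<longleftrightarrow> E f = f"
  by (metis E_idem rangeE rangeI)

lemma Q_op_compose: "f \<in> range E \<Longrightarrow> Q_op q (T o\<^sub>L E) f = Q_op q T f"
  by (simp add: range_E Q_op_apply commute[symmetric])

text \<open>By the factorisation of \<open>Q_op\<close>, the inverse of \<open>z - T\<close> on the
  range of \<open>E\<close> is the inverse of \<open>Q_op\<close> composed with
  \<open>cnj z - T\<close>.\<close>

lemma regular_setI:
  assumes I: "I \<in> \<S>" and res: "slice_emb I z \<in> S_resolvent_set_on (range E) (T o\<^sub>L E)"
  shows "z \<in> regular_set T E"
proof -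
  let ?Q = "Q_op (slice_emb I z) T"
  obtain B K where BW: "\<And>f. f \<in> range E \<Longrightarrow> B f \<in> range E"
    and Blin: "\<And>f g q. f \<in> range E \<Longrightarrow> g \<in> range E \<Longrightarrow> B (f \<cdot> q + g) = B f \<cdot> q + B g"
    and K: "\<And>f. f \<in> range E \<Longrightarrow> norm (B f) \<le> K * norm f"
    and BQ0: "\<And>f. f \<in> range E \<Longrightarrow> B (Q_op (slice_emb I z) (T o\<^sub>L E) f) = f"
      "\<And>f. f \<in> range E \<Longrightarrow> Q_op (slice_emb I z) (T o\<^sub>L E) (B f) = f"
    by (rule S_resolvent_set_onE[OF res], rule that)
  have BQ: "B (?Q f) = f" "?Q (B f) = f" if "f \<in> range E" for f
    using BQ0 BW that by (simp_all add: Q_op_compose)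
  have ER: "E f \<in> range E" for f by simp
  have TE: "T f \<in> range E" if "f \<in> range E" for f
    using that by (simp add: range_E commute[symmetric])
  \<comment> \<open>Extends the inverse from the range of \<open>E\<close> to the whole space by
    zero on the kernel.\<close>
  define R where "R f = B (E f)" for f
  have R_add: "R (f + g) = R f + R g" for f g
    using Blin[OF ER ER, of f 1 g] by (simp add: R_def blinfun.add_right qscale_one)
  have R0: "R 0 = 0" using R_add[of 0 0] by simp
  have R_qscale: "R (f \<cdot> q) = R f \<cdot> q" for f q
    using Blin[OF ER ER, of f q 0] R0 by (simp add: R_def E_qscale)
  have R_minus: "R (f - g) = R f - R g" for f g
    using R_add[of "f - g" g] by simp
  \<comment> \<open>\<open>T\<close> commutes with \<open>Q_op\<close>, hence with its inverse; this
    turns the left inverse property of \<open>G\<close> into the right one.\<close>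
  have T_R: "T (R f) = R (T f)" for f
  proof -
    have "?Q (T (R f)) = T (E f)"
      by (simp add: Q_op_commute R_def BQ(2))
    then show ?thesis
      using BQ(1)[OF TE[OF BW[OF ER]], of f] by (simp add: R_def commute)
  qed
  have EQ: "R (?Q f) = E f" for f
    using BQ(1)[OF ER, of f] by (simp add: R_def Q_op_commute commute)
  have lin: "bounded_linear (\<lambda>f. R (f \<cdot> cquat (cnj z) - T f))"
  proof (rule bounded_linear_compose[of R])
    show "bounded_linear R"
    proof (rule bounded_linear_intro)
      show "R (r *\<^sub>R f) = r *\<^sub>R R f" for r f
        using R_qscale[of f "of_real r"] by simp
      show "norm (R f) \<le> norm f * (\<bar>K\<bar> * norm E)" for f
      proof -
        have "norm (R f) \<le> K * norm (E f)" unfolding R_def by (rule K) simp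
        also have "\<dots> \<le> \<bar>K\<bar> * (norm E * norm f)"
          by (intro mult_mono norm_blinfun) auto
        finally show ?thesis by (simp add: mult_ac)
      qed
    qed (rule R_add)
    show "bounded_linear (\<lambda>f. f \<cdot> cquat (cnj z) - T f)"
      by (intro bounded_linear_sub bounded_linear_qscale_left blinfun.bounded_linear_right)
  qed
  define G where "G = Blinfun (\<lambda>f. R (f \<cdot> cquat (cnj z) - T f))"
  have G: "G f = R (f \<cdot> cquat (cnj z) - T f)" for f
    by (simp add: G_def bounded_linear_Blinfun_apply[OF lin])
  have G': "G f = R f \<cdot> cquat (cnj z) - R (T f)" for f
    by (simp add: G R_minus R_qscale)
  have "G (f \<cdot> cquat z - T f) = E f" for f
    unfolding G using EQ[of f] by (simp add: Q_op_slice_emb[OF I T_qscale])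
  moreover from this have "G f \<cdot> cquat z - T (G f) = E f" for f
    by (simp add: G' R_minus R_qscale T_R T_qscale blinfun.diff_right qscale_diff_left
        qscale_cquat_commute[of _ z] algebra_simps)
  moreover have "E (R f) = R f" for f
    using BW[OF ER, of f] by (simp add: R_def range_E)
  then have "E (G f) = G f" for f
    by (simp add: G)
  moreover have "G (E f) = G f" for f
    by (simp add: G' commute) (simp add: R_def E_idem)
  ultimately have "resolvent_at T E z G"
    by (simp add: resolvent_at_def)
  then show ?thesis by (auto simp: regular_set_def)
qed

text \<open>\<open>E\<close> commutes with \<open>Q_op\<close>, hence with its inverse
  \<open>B\<close>, so \<open>B\<close> preserves the range of \<open>E\<close> and inverts the
  restriction there.\<close>

lemma S_resolvent_set_restrict:
  assumes "q \<in> \<rho>\<^sub>S T"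
  shows "q \<in> S_resolvent_set_on (range E) (T o\<^sub>L E)"
proof -
  let ?Q = "Q_op q T"
  obtain B K where Blin: "\<And>f g p. B (f \<cdot> p + g) = B f \<cdot> p + B g"
    and K: "\<And>f. norm (B f) \<le> K * norm f"
    and BQ: "\<And>f. B (?Q f) = f" "\<And>f. ?Q (B f) = f"
    by (rule S_resolvent_setE[OF assms(1)], rule that)
  have "E (B f) = B (E f)" for f
    by (metis BQ Q_op_commute commute)
  then have BW: "B f \<in> range E" if "f \<in> range E" for f
    using that by (metis range_E)
  have QB: "Q_op q (T o\<^sub>L E) (B f) = f" "B (Q_op q (T o\<^sub>L E) f) = f" if "f \<in> range E" for f
    using that BW BQ by (simp_all add: Q_op_compose)
  have "f \<in> Q_op q (T o\<^sub>L E) ` range E" if "f \<in> range E" for f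
    using QB(1)[OF that] BW[OF that] by (metis imageI)
  then have "range E \<subseteq> closure (Q_op q (T o\<^sub>L E) ` range E)"
    using closure_subset by blast
  moreover have "0 \<in> range E" by (simp add: range_E blinfun.zero_right)
  then have "{f \<in> range E. Q_op q (T o\<^sub>L E) f = 0} = {0}"
    using QB(2) by (auto simp: blinfun.zero_right) (metis QB(2) blinfun.zero_right rangeI)+
  moreover have "bounded_right_linear_on (range E) B"
    unfolding bounded_right_linear_on_def using BW Blin K by blast
  ultimately show ?thesis
    using QB unfolding S_resolvent_set_on_def by blast
qed

lemma holomorphic_family_cresolvent:
  "holomorphic_family (regular_set T E) (cresolvent T E)"
  by unfold_locales
    (auto intro: open_regular_set continuous_on_cresolvent cresolvent_holomorphic
      resolvent_at_cquat cresolvent)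

end

text \<open>If \<open>A\<close> and \<open>B\<close> are quaternionic linear, \<open>jconj\<close> maps \<open>A + \<i> B\<close> to \<open>A - \<i> B\<close>, and \<open>slice_transfer L\<close>
  maps it to \<open>B - A L\<close>.\<close>

definition qj :: quat where "qj = Quat 0 0 1 0"

definition jmul :: "'v::right_quaternionic_hilbert_space \<Rightarrow>\<^sub>L 'v" where
  "jmul = Blinfun (\<lambda>f. f \<cdot> qj)"

lemma jmul_apply [simp]: "jmul f = f \<cdot> qj"
  by (simp add: jmul_def bounded_linear_Blinfun_apply bounded_linear_qscale_left)

definition jconj ::
  "('v::right_quaternionic_hilbert_space \<Rightarrow>\<^sub>L 'v) \<Rightarrow> 'v \<Rightarrow>\<^sub>L 'v" where
  "jconj X = - (jmul o\<^sub>L (X o\<^sub>L jmul))"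

definition slice_transfer ::
  "('v::right_quaternionic_hilbert_space \<Rightarrow>\<^sub>L 'v) \<Rightarrow> ('v \<Rightarrow>\<^sub>L 'v) \<Rightarrow> 'v \<Rightarrow>\<^sub>L 'v" where
  "slice_transfer L X = (1/2) *\<^sub>R ((cmul (- \<i>) o\<^sub>L (X - jconj X)) - ((X + jconj X) o\<^sub>L L))"

lemma bounded_linear_slice_transfer: "bounded_linear (slice_transfer L)"
proof -
  note comp = bounded_bilinear.bounded_linear_right[OF bounded_bilinear_blinfun_compose]
    bounded_bilinear.bounded_linear_left[OF bounded_bilinear_blinfun_compose]
  have "bounded_linear jconj"
    unfolding jconj_def[abs_def]
    by (intro bounded_linear_minus bounded_linear_compose[OF comp(1)] comp(2))
  then show ?thesis
    unfolding slice_transfer_def[abs_def]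
    by (intro bounded_linear_compose[OF bounded_linear_scaleR_right] bounded_linear_sub
        bounded_linear_add bounded_linear_compose[OF comp(1)] bounded_linear_compose[OF comp(2)]
        bounded_linear_ident)
qed

lemma slice_transfer_qscale:
  fixes Y :: "'v::right_quaternionic_hilbert_space \<Rightarrow>\<^sub>L 'v"
  assumes Y: "\<And>f q. Y (f \<cdot> q) = Y f \<cdot> q"
  shows "slice_transfer L (cmul a o\<^sub>L Y) f = Im a *\<^sub>R Y f - Re a *\<^sub>R Y (L f)"
proof -
  have conj: "jconj (cmul a o\<^sub>L Y) g = Y g \<cdot> cquat (cnj a)" for g
  proof -
    \<comment> \<open>Conjugation by the unit \<open>qj\<close> is complex conjugation on the range
      of \<open>cquat\<close>; sum and difference with \<open>jconj\<close> therefore isolate the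
      real and imaginary parts of \<open>a\<close>.\<close>
    have "- (qj * cquat a * qj) = cquat (cnj a)"
      by (simp add: qj_def cquat_def quat_defs)
    then show ?thesis
      by (simp add: jconj_def blinfun.minus_left Y qscale_qscale qscale_minus_right[symmetric]
          mult.assoc)
  qed
  have "(Y g \<cdot> cquat a - Y g \<cdot> cquat (cnj a)) \<cdot> cquat (- \<i>) = (2 * Im a) *\<^sub>R Y g" for g
  proof -
    have "(cquat a - cquat (cnj a)) * cquat (- \<i>) = of_real (2 * Im a)"
      unfolding cquat_simps(2,3,7)[symmetric] by (rule arg_cong[where f = cquat])
        (simp add: complex_eq_iff)
    then show ?thesis
      by (simp only: qscale_diff_right[symmetric] qscale_qscale qscale_of_real)
  qed
  moreover have "Y g \<cdot> cquat a + Y g \<cdot> cquat (cnj a) = (2 * Re a) *\<^sub>R Y g" for g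
    by (simp only: qscale_add_right[symmetric] cquat_simps(1)[symmetric] complex_add_cnj
        cquat_simps(7) qscale_of_real)
  ultimately have "(cmul (- \<i>) o\<^sub>L ((cmul a o\<^sub>L Y) - jconj (cmul a o\<^sub>L Y))) f = (2 * Im a) *\<^sub>R Y f"
      "(((cmul a o\<^sub>L Y) + jconj (cmul a o\<^sub>L Y)) o\<^sub>L L) f = (2 * Re a) *\<^sub>R Y (L f)"
    by (simp_all only: blinfun_apply_blinfun_compose blinfun.diff_left blinfun.add_left conj cmul_apply)
  then show ?thesis
    by (simp only: slice_transfer_def blinfun.scaleR_left blinfun.diff_left)
      (simp add: scaleR_diff_right)
qed

section \<open>The integrand of the Riesz projection\<close>

lemma left_mult_slice_emb:
  assumes "hilbert_basis N"
  shows "left_mult N (slice_emb I z) f = Re z *\<^sub>R f + Im z *\<^sub>R left_mult N I f"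
proof -
  have "slice_emb I z = Re z *\<^sub>R 1 + Im z *\<^sub>R I"
    by (simp add: slice_emb_def of_real_def)
  then show ?thesis
    by (simp add: left_mult_add[OF assms] left_mult_scaleR[OF assms] left_mult_one[OF assms]
        blinfun.bilinear_simps)
qed

text \<open>Identifies the formal inverse in \<open>left_S_resolvent\<close> with the bounded right
  linear inverse that membership in \<open>\<rho>\<^sub>S T\<close> provides; \<open>Blinfun\<close>
  is meaningful only because of that boundedness.\<close>

lemma inverse_Q_op:
  fixes T :: "'v::right_quaternionic_hilbert_space \<Rightarrow>\<^sub>L 'v"
  assumes "q \<in> \<rho>\<^sub>S T"
  defines "R \<equiv> Blinfun (inv (blinfun_apply (Q_op q T)))"
  shows "R (Q_op q T f) = f" "R (f \<cdot> p) = R f \<cdot> p"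
proof -
  let ?Q = "Q_op q T"
  obtain B K where Blin: "\<And>f g p. B (f \<cdot> p + g) = B f \<cdot> p + B g"
    and K: "\<And>f. norm (B f) \<le> K * norm f"
    and BQ: "\<And>f. B (?Q f) = f" "\<And>f. ?Q (B f) = f"
    by (rule S_resolvent_setE[OF assms(1)], rule that)
  have add: "B (f + g) = B f + B g" for f g using Blin[of f 1 g] by (simp add: qscale_one)
  have "B 0 = 0" using add[of 0 0] by simp
  then have scale: "B (f \<cdot> p) = B f \<cdot> p" for f p using Blin[of f p 0] by simp
  have "bounded_linear B"
  proof (rule bounded_linear_intro[where K = K])
    show "B (r *\<^sub>R f) = r *\<^sub>R B f" for r f using scale[of f "of_real r"] by simp
  qed (use add K in \<open>simp_all add: mult.commute\<close>)
  moreover have "inv (blinfun_apply ?Q) = B"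
    by (rule inv_equality) (use BQ in auto)
  ultimately have "blinfun_apply R = B"
    by (simp add: R_def bounded_linear_Blinfun_apply)
  then show "R (?Q f) = f" "R (f \<cdot> p) = R f \<cdot> p"
    using BQ scale by simp_all
qed

text \<open>The bridge between the two integrals: \<open>slice_transfer\<close> turns the complex
  integrand \<open>(z - T)^-1 dz\<close> into the quaternionic one. Both sides are expanded in terms
  of \<open>R\<close> and \<open>?L\<close>.\<close>

lemma slice_transfer_resolvent:
  fixes T G :: "'v::right_quaternionic_hilbert_space \<Rightarrow>\<^sub>L 'v"
  assumes N: "hilbert_basis N" and I: "I \<in> \<S>" and T: "\<And>f q. T (f \<cdot> q) = T f \<cdot> q"
    and z: "slice_emb I z \<in> \<rho>\<^sub>S T"
    and G: "\<And>f. G f \<cdot> cquat z - T (G f) = f"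
  shows "slice_transfer (left_mult N I) (G o\<^sub>L cmul d)
    = left_S_resolvent N (slice_emb I z) T o\<^sub>L left_mult N (- slice_emb I d * I)"
proof (rule blinfun_eqI)
  fix f
  let ?q = "slice_emb I z" and ?L = "left_mult N I" and ?a = "cnj z * d"
  define R where "R = Blinfun (inv (blinfun_apply (Q_op ?q T)))"
  note R = inverse_Q_op[OF z, folded R_def]
  \<comment> \<open>Since \<open>G\<close> is a right inverse of \<open>z - T\<close>, the
    factorisation reduces \<open>Q_op ?q T (G f)\<close> to \<open>(cnj z - T) f\<close>.\<close>
  have Geq: "G f = R f \<cdot> cquat (cnj z) - R (T f)" for f
  proof -
    have "Q_op ?q T (G f) = f \<cdot> cquat (cnj z) - T f"
      by (simp add: Q_op_slice_emb[OF I T] G)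
    then show ?thesis
      using R(1)[of "G f"] by (simp add: blinfun.diff_right R(2))
  qed
  have GC: "G o\<^sub>L cmul d = (cmul ?a o\<^sub>L R) - (cmul d o\<^sub>L (R o\<^sub>L T))"
    by (rule blinfun_eqI)
      (simp add: Geq T R(2) blinfun.diff_left cquat_simps(3) qscale_qscale[symmetric]
        qscale_cquat_commute[of _ d])
  have lin: "linear (slice_transfer ?L)"
    using bounded_linear_slice_transfer bounded_linear.linear by blast
  have lhs: "slice_transfer ?L (G o\<^sub>L cmul d) f
      = (Im ?a *\<^sub>R R f - Re ?a *\<^sub>R R (?L f)) - (Im d *\<^sub>R R (T f) - Re d *\<^sub>R R (T (?L f)))"
    unfolding GC linear_diff[OF lin] blinfun.diff_left
    by (subst (1 2) slice_transfer_qscale) (simp_all add: R(2) T)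
  \<comment> \<open>Multiplication by \<open>- I\<close> is multiplication by \<open>- \<i>\<close>
    in the slice coordinate: the real part of the product is \<open>Im d\<close> and the imaginary
    part is \<open>- Re d\<close>.\<close>
  have e1: "- slice_emb I d * I = slice_emb I (- d * \<i>)"
    by (simp add: slice_emb_simps[OF I])
  have e2: "qcnj ?q * (- slice_emb I d * I) = slice_emb I (- ?a * \<i>)"
    by (simp add: slice_emb_simps[OF I] mult.assoc)
  have "left_mult N (qcnj ?q) (left_mult N (- slice_emb I d * I) f)
      = left_mult N (qcnj ?q * (- slice_emb I d * I)) f"
    by (simp only: left_mult_mult[OF N, of "qcnj ?q"] blinfun_apply_blinfun_compose)
  also have "\<dots> = Im ?a *\<^sub>R f - Re ?a *\<^sub>R ?L f"
    unfolding e2 by (subst left_mult_slice_emb[OF N]) (simp add: algebra_simps)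
  finally have "left_mult N (qcnj ?q) (left_mult N (- slice_emb I d * I) f)
      = Im ?a *\<^sub>R f - Re ?a *\<^sub>R ?L f" .
  moreover have "left_mult N (- slice_emb I d * I) f = Im d *\<^sub>R f - Re d *\<^sub>R ?L f"
    unfolding e1 by (subst left_mult_slice_emb[OF N]) simp
  ultimately have rhs: "(left_S_resolvent N ?q T o\<^sub>L left_mult N (- slice_emb I d * I)) f
      = - R (T (Im d *\<^sub>R f - Re d *\<^sub>R ?L f) - (Im ?a *\<^sub>R f - Re ?a *\<^sub>R ?L f))"
    by (simp only: left_S_resolvent_def R_def[symmetric] blinfun_apply_blinfun_compose
        blinfun.minus_left blinfun.diff_left)
  show "slice_transfer ?L (G o\<^sub>L cmul d) f
      = (left_S_resolvent N ?q T o\<^sub>L left_mult N (- slice_emb I d * I)) f"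
    unfolding lhs rhs by (simp only: blinfun.diff_right blinfun.scaleR_right) simp
qed

lemma vector_derivative_slice_emb:
  assumes "\<gamma> differentiable (at t)" "0 \<le> t" "t \<le> 1"
  shows "vector_derivative (slice_emb I \<circ> \<gamma>) (at t within {0..1})
    = slice_emb I (vector_derivative \<gamma> (at t within {0..1}))"
proof -
  have "(\<gamma> has_vector_derivative vector_derivative \<gamma> (at t)) (at t)"
    using assms by (simp add: vector_derivative_works)
  then have "(\<gamma> has_vector_derivative vector_derivative \<gamma> (at t within {0..1})) (at t)"
    using assms by (simp add: vector_derivative_at_within_ivl)
  moreover have "bounded_linear (\<lambda>z. Re z *\<^sub>R (1::quat) + Im z *\<^sub>R I)"
    by (intro bounded_linear_add bounded_linear_compose[OF bounded_linear_scaleR_left]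
        bounded_linear_Re bounded_linear_Im)
  then have "bounded_linear (slice_emb I)"
    by (simp add: slice_emb_def[abs_def] of_real_def)
  ultimately have "(slice_emb I \<circ> \<gamma> has_vector_derivative
      slice_emb I (vector_derivative \<gamma> (at t within {0..1}))) (at t)"
    by (simp add: bounded_linear.has_vector_derivative o_def)
  then show ?thesis
    using assms by (intro vector_derivative_at_within_ivl) auto
qed

lemma slice_integral_transfer:
  assumes \<gamma>: "valid_path \<gamma>"
    and eq: "\<And>t. t \<in> {0..1} \<Longrightarrow> slice_transfer L
        (\<Phi> t o\<^sub>L cmul (vector_derivative \<gamma> (at t within {0..1})))
      = F (slice_emb I (\<gamma> t)) o\<^sub>L
        left_mult N (- slice_emb I (vector_derivative \<gamma> (at t within {0..1})) * I)"
    and int: "((\<lambda>t. \<Phi> t o\<^sub>L cmul (vector_derivative \<gamma> (at t within {0..1}))) has_integral M) {0..1}"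
  shows "slice_integral N I \<gamma> F = slice_transfer L M"
proof -
  from \<gamma> obtain k where k: "finite k" "\<gamma> C1_differentiable_on ({0..1} - k)"
    by (auto simp: valid_path_def piecewise_C1_differentiable_on_def)
  have "((\<lambda>t. slice_transfer L (\<Phi> t o\<^sub>L cmul (vector_derivative \<gamma> (at t within {0..1}))))
      has_integral slice_transfer L M) {0..1}"
    using has_integral_linear[OF int bounded_linear_slice_transfer] by (simp add: o_def)
  then have "((\<lambda>t. F (slice_emb I (\<gamma> t)) o\<^sub>L left_mult N
      (- vector_derivative (slice_emb I \<circ> \<gamma>) (at t within {0..1}) * I))
      has_integral slice_transfer L M) {0..1}"
  \<comment> \<open>At the finitely many break points in \<open>k\<close> the derivative need not
    commute with \<open>slice_emb I\<close>; they do not affect the integral.\<close>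
  proof (rule has_integral_spike_finite[OF k(1), rotated])
    fix t assume "t \<in> {0..1} - k"
    then show "F (slice_emb I (\<gamma> t)) o\<^sub>L left_mult N
        (- vector_derivative (slice_emb I \<circ> \<gamma>) (at t within {0..1}) * I)
      = slice_transfer L (\<Phi> t o\<^sub>L cmul (vector_derivative \<gamma> (at t within {0..1})))"
      using k(2) by (subst vector_derivative_slice_emb) (auto simp: C1_differentiable_on_eq eq)
  qed
  then show ?thesis
    unfolding slice_integral_def by (rule integral_unique)
qed

lemma linear_sum_list: "linear f \<Longrightarrow> f (\<Sum>x\<leftarrow>xs. g x) = (\<Sum>x\<leftarrow>xs. f (g x))"
  by (induction xs) (simp_all add: linear_0 linear_add)

lemma blinfun_sum_list: "blinfun_apply (\<Sum>x\<leftarrow>xs. g x) f = (\<Sum>x\<leftarrow>xs. blinfun_apply (g x) f)"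
  by (induction xs) (simp_all add: blinfun.bilinear_simps)

text \<open>A common point would bring the infimum down to zero. The separation of the two spectra
  enters in this form.\<close>

lemma set_distance_pos_disjoint:
  assumes "set_distance A B > 0"
  shows "A \<inter> B = {}"
proof (rule ccontr)
  assume "A \<inter> B \<noteq> {}"
  then obtain x where "x \<in> A" "x \<in> B" by blast
  then have "set_distance A B \<le> ereal (dist x x)"
    unfolding set_distance_def by (meson INF_lower2 order_refl)
  with assms show False
    by (metis dist_self leD zero_ereal_def)
qed

section \<open>Evaluation of the Riesz projection\<close>

theorem riesz_projection_eq:
  fixes T P :: "'v::right_quaternionic_hilbert_space \<Rightarrow>\<^sub>L 'v"
  assumes basis: "hilbert_basis N"
    and T: "T \<in> \<B>" and P: "P \<in> \<B>" "P o\<^sub>L P = P" and commute: "T o\<^sub>L P = P o\<^sub>L T"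
    and disj: "S_spectrum_on (range P) (T o\<^sub>L P)
      \<inter> S_spectrum_on {f. P f = 0} (T o\<^sub>L (id_blinfun - P)) = {}"
    and domain: "riesz_domain T (S_spectrum_on (range P) (T o\<^sub>L P)) U"
    and I: "I \<in> \<S>" and \<Gamma>: "oriented_boundary I U \<Gamma>"
  shows "riesz_projection N I \<Gamma> T = P"
proof -
  let ?P' = "id_blinfun - P"
  have TP: "T (f \<cdot> q) = T f \<cdot> q" "P (f \<cdot> q) = P f \<cdot> q" "P (P f) = P f" "T (P f) = P (T f)" for f q
    using T P commute
    by (auto simp: right_linear_ops_def dest: arg_cong[where f = "\<lambda>X. blinfun_apply X f"])
  interpret A: commuting_idempotent T P
    by unfold_locales (simp_all add: TP)
  interpret B: commuting_idempotent T ?P'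
    by unfold_locales (simp_all add: TP blinfun.bilinear_simps qscale_diff_left)
  interpret FA: holomorphic_family "regular_set T P" "cresolvent T P"
    by (rule A.holomorphic_family_cresolvent)
  interpret FB: holomorphic_family "regular_set T ?P'" "cresolvent T ?P'"
    by (rule B.holomorphic_family_cresolvent)
  have kernel: "{f. P f = 0} = range ?P'"
    using B.range_E by (auto simp: blinfun.bilinear_simps)
  define D where "D = slice_emb I -` U"
  have D: "open D" "connected D" "D \<noteq> {}"
    using slice_preimage[OF I] domain by (auto simp: D_def riesz_domain_def)
  have front: "slice_frontier I U = slice_emb I ` frontier D"
    by (simp add: slice_frontier_eq[OF I] D_def)
  have curves: "valid_path \<gamma> \<and> simple_path \<gamma> \<and> pathfinish \<gamma> = pathstart \<gamma>" if "\<gamma> \<in> set \<Gamma>" for \<gamma>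
    using \<Gamma> that by (simp add: oriented_boundary_def)
  have "slice_emb I ` frontier D = slice_emb I ` (\<Union>\<gamma>\<in>set \<Gamma>. path_image \<gamma>)"
    using \<Gamma> by (simp add: oriented_boundary_def front image_UN)
  then have frontier: "frontier D = (\<Union>\<gamma>\<in>set \<Gamma>. path_image \<gamma>)"
    using inj_slice_emb[OF I] by (simp add: inj_image_eq_iff)
  have one: "(\<Sum>\<gamma>\<leftarrow>\<Gamma>. winding_number \<gamma> z) = 1" if "z \<in> D" for z
    using \<Gamma> that by (simp add: oriented_boundary_def D_def)
  have zero: "(\<Sum>\<gamma>\<leftarrow>\<Gamma>. winding_number \<gamma> z) = 0" if "z \<notin> D \<union> frontier D" for z
    using \<Gamma> that inj_slice_emb[OF I]
    by (simp add: oriented_boundary_def front inj_image_mem_iff D_def)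
  have frontier_res: "slice_emb I z \<in> \<rho>\<^sub>S T" if "z \<in> frontier D" for z
    using domain I front that by (auto simp: riesz_domain_def)
  \<comment> \<open>The spectrum of the part on the range of \<open>P\<close> is contained in
    \<open>U\<close>, so off \<open>D\<close> the resolvent relative to \<open>P\<close>
    exists.\<close>
  have regA: "- D \<subseteq> regular_set T P"
  proof
    fix z assume "z \<in> - D"
    then have "slice_emb I z \<notin> S_spectrum_on (range P) (T o\<^sub>L P)"
      using domain by (auto simp: D_def riesz_domain_def)
    then show "z \<in> regular_set T P"
      by (intro A.regular_setI[OF I]) (simp add: S_spectrum_on_def)
  qed
  \<comment> \<open>On the frontier \<open>T\<close> itself has an S-resolvent, which restricts. A
    spectral point of \<open>T\<close> inside \<open>D\<close> belongs to the first spectrum, hence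
    by disjointness not to the second.\<close>
  have regB: "closure D \<subseteq> regular_set T ?P'"
  proof
    fix z assume z: "z \<in> closure D"
    have "slice_emb I z \<in> S_resolvent_set_on (range ?P') (T o\<^sub>L ?P')"
    proof (cases "slice_emb I z \<in> \<rho>\<^sub>S T")
      case True
      then show ?thesis by (rule B.S_resolvent_set_restrict)
    next
      case False
      then have "z \<in> D"
        using z frontier_res closure_Un_frontier by blast
      then have "slice_emb I z \<in> S_spectrum_on (range P) (T o\<^sub>L P)"
        using domain False by (auto simp: D_def riesz_domain_def S_spectrum_on_def)
      then show ?thesis using disj by (auto simp: kernel S_spectrum_on_def)
    qed
    then show "z \<in> regular_set T ?P'" by (rule B.regular_setI[OF I])
  qed
  have paths: "path_image \<gamma> \<subseteq> frontier D" if "\<gamma> \<in> set \<Gamma>" for \<gamma>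
    using that frontier by blast
  have fr: "frontier D \<subseteq> regular_set T P" "frontier D \<subseteq> regular_set T ?P'"
    using regA regB frontier_disjoint_eq[of D] D(1) by (auto simp: frontier_def)
  have sumA: "(\<Sum>\<gamma>\<leftarrow>\<Gamma>. FA.op_path_integral \<gamma>) = cmul \<i> o\<^sub>L ((2 * pi) *\<^sub>R P)"
  proof (rule blinfun_complex_form_eqI)
    fix h f
    have "complex_form h ((\<Sum>\<gamma>\<leftarrow>\<Gamma>. FA.op_path_integral \<gamma>) f)
        = (\<Sum>\<gamma>\<leftarrow>\<Gamma>. complex_form h (FA.op_path_integral \<gamma> f))"
      by (simp add: blinfun_sum_list linear_sum_list bounded_linear.linear bounded_linear_complex_form)
    also have "\<dots> = (\<Sum>\<gamma>\<leftarrow>\<Gamma>. contour_integral \<gamma> (\<lambda>z. complex_form h (cresolvent T P z f)))"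
      using curves paths fr(1)
      by (intro arg_cong[where f = sum_list] map_cong refl FA.complex_form_op_path_integral) blast+
    also have "\<dots> = 2 * complex_of_real pi * \<i> * complex_form h (P f)"
      \<comment> \<open>The asymptotic bound for the resolvent identifies the residue constant as
        \<open>complex_form h (P f)\<close>.\<close>
      using residue_at_infinity_boundary[OF D curves frontier one A.open_regular_set regA
          A.cresolvent_holomorphic A.cresolvent_asymptotic] by simp
    also have "\<dots> = complex_form h ((cmul \<i> o\<^sub>L ((2 * pi) *\<^sub>R P)) f)"
      using linear_scale[OF bounded_linear.linear[OF bounded_linear_complex_form], of h "2 * pi" "P f"]
      by (simp add: blinfun.scaleR_left complex_form_cquat scaleR_conv_of_real)
    finally show "complex_form h ((\<Sum>\<gamma>\<leftarrow>\<Gamma>. FA.op_path_integral \<gamma>) f)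
      = complex_form h ((cmul \<i> o\<^sub>L ((2 * pi) *\<^sub>R P)) f)" .
  qed
  have sumB: "(\<Sum>\<gamma>\<leftarrow>\<Gamma>. FB.op_path_integral \<gamma>) = 0"
  proof (rule blinfun_complex_form_eqI)
    fix h f
    have "complex_form h ((\<Sum>\<gamma>\<leftarrow>\<Gamma>. FB.op_path_integral \<gamma>) f)
        = (\<Sum>\<gamma>\<leftarrow>\<Gamma>. complex_form h (FB.op_path_integral \<gamma> f))"
      by (simp add: blinfun_sum_list linear_sum_list bounded_linear.linear bounded_linear_complex_form)
    also have "\<dots> = (\<Sum>\<gamma>\<leftarrow>\<Gamma>. contour_integral \<gamma> (\<lambda>z. complex_form h (cresolvent T ?P' z f)))"
      using curves paths fr(2)
      by (intro arg_cong[where f = sum_list] map_cong refl FB.complex_form_op_path_integral) blast+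
    also have "\<dots> = 0"
      \<comment> \<open>Relative to \<open>?P'\<close> the resolvent has no singularity in the
        closure of \<open>D\<close>.\<close>
      by (rule Cauchy_theorem_boundary[OF D(1,2) curves frontier zero B.open_regular_set regB
            B.cresolvent_holomorphic])
    finally show "complex_form h ((\<Sum>\<gamma>\<leftarrow>\<Gamma>. FB.op_path_integral \<gamma>) f) = complex_form h (blinfun_apply 0 f)"
      using linear_0[OF bounded_linear.linear[OF bounded_linear_complex_form], of h] by simp
  qed
  let ?L = "left_mult N I"
  have lin: "linear (slice_transfer ?L)"
    using bounded_linear_slice_transfer bounded_linear.linear by blast
  have "slice_integral N I \<gamma> (\<lambda>q. left_S_resolvent N q T)
      = slice_transfer ?L (FA.op_path_integral \<gamma> + FB.op_path_integral \<gamma>)" if "\<gamma> \<in> set \<Gamma>" for \<gamma>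
  \<comment> \<open>On the curves the two relative resolvents add up to the full inverse of
    \<open>z - T\<close>, because \<open>P\<close> and \<open>?P'\<close> add up to the
    identity.\<close>
  proof (rule slice_integral_transfer[where \<Phi> = "\<lambda>t. cresolvent T P (\<gamma> t) + cresolvent T ?P' (\<gamma> t)"])
    note \<gamma> = curves[OF that] paths[OF that]
    show "valid_path \<gamma>" using \<gamma> by blast
    show "((\<lambda>t. (cresolvent T P (\<gamma> t) + cresolvent T ?P' (\<gamma> t)) o\<^sub>L
        cmul (vector_derivative \<gamma> (at t within {0..1})))
      has_integral FA.op_path_integral \<gamma> + FB.op_path_integral \<gamma>) {0..1}"
      unfolding bounded_bilinear.add_left[OF bounded_bilinear_blinfun_compose]
      using \<gamma> fr
      by (intro has_integral_add FA.has_integral_op_path_integral FB.has_integral_op_path_integral)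
        blast+
    fix t :: real assume "t \<in> {0..1}"
    then have t: "\<gamma> t \<in> frontier D" using \<gamma>(2) by (auto simp: path_image_def)
    have "(cresolvent T P (\<gamma> t) + cresolvent T ?P' (\<gamma> t)) f \<cdot> cquat (\<gamma> t)
        - T ((cresolvent T P (\<gamma> t) + cresolvent T ?P' (\<gamma> t)) f) = f" for f
      using A.resolvent_atD(1)[OF A.cresolvent, of "\<gamma> t" f]
        B.resolvent_atD(1)[OF B.cresolvent, of "\<gamma> t" f] t fr
      by (simp add: blinfun.bilinear_simps qscale_add_left subset_iff algebra_simps)
    then show "slice_transfer ?L ((cresolvent T P (\<gamma> t) + cresolvent T ?P' (\<gamma> t)) o\<^sub>L
        cmul (vector_derivative \<gamma> (at t within {0..1})))
      = left_S_resolvent N (slice_emb I (\<gamma> t)) T o\<^sub>L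
        left_mult N (- slice_emb I (vector_derivative \<gamma> (at t within {0..1})) * I)"
      by (intro slice_transfer_resolvent[OF basis I TP(1) frontier_res[OF t]])
  qed
  then have "(\<Sum>\<gamma>\<leftarrow>\<Gamma>. slice_integral N I \<gamma> (\<lambda>q. left_S_resolvent N q T))
      = (\<Sum>\<gamma>\<leftarrow>\<Gamma>. slice_transfer ?L (FA.op_path_integral \<gamma> + FB.op_path_integral \<gamma>))"
    by (intro arg_cong[where f = sum_list] map_cong refl)
  also have "\<dots> = slice_transfer ?L (cmul \<i> o\<^sub>L ((2 * pi) *\<^sub>R P))"
    using sumA sumB by (simp add: linear_sum_list[OF lin, symmetric] sum_list_addf)
  also have "\<dots> = (2 * pi) *\<^sub>R P"
    \<comment> \<open>For \<open>a = \<i>\<close> the real part is \<open>0\<close> and the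
      imaginary part is \<open>1\<close>, so the term with \<open>?L\<close> disappears and with it
      the dependence on the basis and the slice.\<close>
    by (rule blinfun_eqI) (subst slice_transfer_qscale;
        simp add: blinfun.scaleR_left TP qscale_scaleR_left)
  finally show ?thesis
    by (simp add: riesz_projection_def)
qed

theorem theorem3p6:
  fixes T P :: "'v::right_quaternionic_hilbert_space \<Rightarrow>\<^sub>L 'v"
    and N :: "'v set" and \<sigma>1 \<sigma>2 U :: "quat set" and I :: quat
    and \<Gamma> :: "(real \<Rightarrow> complex) list"
  assumes separable: "\<exists>D::'v set. countable D \<and> closure D = UNIV"
    and infinite_dimensional: "\<nexists>B::'v set. finite B \<and> qspan B = UNIV"
    and basis: "hilbert_basis N"
    and T: "T \<in> \<B>"
    and P: "P \<in> \<B>" "P o\<^sub>L P = P"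
    and commute: "T o\<^sub>L P = P o\<^sub>L T"
    and \<sigma>1: "\<sigma>1 = S_spectrum_on (range P) (T o\<^sub>L P)"
    and \<sigma>2: "\<sigma>2 = S_spectrum_on {f. P f = 0} (T o\<^sub>L (id_blinfun - P))"
    and dist: "set_distance \<sigma>1 \<sigma>2 > 0"
    and domain: "riesz_domain T \<sigma>1 U"
    and slice: "I \<in> \<S>" "oriented_boundary I U \<Gamma>"
  shows "range P = range (riesz_projection N I \<Gamma> T) \<and>
    {f. P f = 0} = {f. riesz_projection N I \<Gamma> T f = 0}"
  using riesz_projection_eq[OF basis T P commute _ _ slice] set_distance_pos_disjoint[OF dist] domain
  unfolding \<sigma>1 \<sigma>2 by simp

end
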